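(* Let $\alpha\in(0,1]$, let $Z$ be a Banach space and $A\in C(\mathbb{R}_+,\mathcal{B}(Z))$. Assume that $\mathcal{T}^\alpha x=A(t)x$ admits a nonuniform Mittag-Leffler dichotomy in $\mathbb{R}_+$ with constants $\hat N_1,\hat N_2,\hat\beta_1,\hat\beta_2>0$ and $\epsilon\ge0$, where $\epsilon<\min\{\hat\beta_1,\hat\beta_2\}$. Then there is $\delta_0>0$ such that the following holds for every $\delta<\delta_0$ satisfying $\theta:=\delta\left(\frac{\hat N_1}{\hat\beta_1}+\frac{\hat N_2}{\hat\beta_2}\right)<1$ and every $B\in C_b(\mathbb{R}_+,\mathcal{B}(Z))$ with $\|B(t)\|\le\delta/E_\alpha(2\epsilon,t)$ for all $t\in\mathbb{R}_+$: the equation $\mathcal{T}^\alpha x=[A(t)+B(t)]x$ also admits a nonuniform Mittag-Leffler dichotomy in $\mathbb{R}_+$.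
   Context: $\mathbb{R}_+=[0,\infty)$. $\mathcal{B}(Z)$ is the Banach space of bounded linear operators on $Z$ with the operator norm; $C_b$ denotes bounded continuous functions. For $\alpha\in(0,1]$, $\mathcal{T}^\alpha g(t):=\lim_{\varepsilon\to0}\frac{g(t+\varepsilon|t|^{1-\alpha})-g(t)}{\varepsilon}$ (so $\mathcal{T}^\alpha g(t)=|t|^{1-\alpha}g'(t)$ for $t\ne0$), with $\mathcal{T}^\alpha g(0):=\lim_{t\to0}\mathcal{T}^\alpha g(t)$ if this limit exists; solutions are continuous functions satisfying the equation. $E_\alpha(\lambda,t):=\exp(\lambda t^\alpha/\alpha)$ for $t\ge0$. The evolution operators $T(t,s)$ of a linear equation are the bounded linear operators with $x(t)=T(t,s)x(s)$ for every solution $x$; they satisfy $T(t,t)=\mathrm{Id}$, $T(t,s)T(s,\tau)=T(t,\tau)$, $T(t,s)^{-1}=T(s,t)$. A linear equation with evolution operator $T(t,s)$ admits a nonuniform Mittag-Leffler dichotomy in $\mathbb{R}_+$ if there are projections $P(t)\in\mathcal{B}(Z)$ ($P(t)^2=P(t)$), $t\in\mathbb{R}_+$, with $T(t,s)P(s)=P(t)T(t,s)$ for $t\ge s$, and constants $\hat N_i,\hat\beta_i>0$ ($i=1,2$), $\epsilon\ge0$ such that for $t,s\in\mathbb{R}_+$: $\|T(t,s)P(s)\|\le\hat N_1\frac{E_\alpha(\hat\beta_1,s)}{E_\alpha(\hat\beta_1,t)}E_\alpha(\epsilon,s)$ for $t\ge s$, and $\|T(t,s)(\mathrm{Id}-P(s))\|\le\hat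 N_2\frac{E_\alpha(\hat\beta_2,t)}{E_\alpha(\hat\beta_2,s)}E_\alpha(\epsilon,s)$ for $s\ge t$. (The constants for the perturbed equation, including its $\epsilon$, may differ from those of the original equation.) *)

theory Defs
  imports "HOL-Analysis.Analysis"
begin

definition conf_quotient :: "real \<Rightarrow> (real \<Rightarrow> 'z::real_normed_vector) \<Rightarrow> real \<Rightarrow> real \<Rightarrow> 'z" where
  "conf_quotient \<alpha> g t e = (g (t + e * \<bar>t\<bar> powr (1 - \<alpha>)) - g t) /\<^sub>R e"

(* "The conformable derivative of order alpha of g at t exists and equals L", for functions on the
   half-line {0..} (values of g at negative arguments are irrelevant).  At t = 0 the value is by
   convention the limit of the derivatives at points t > 0, even for alpha = 1. *)
definition has_conf_deriv ::
    "real \<Rightarrow> (real \<Rightarrow> 'z::real_normed_vector) \<Rightarrow> 'z \<Rightarrow> real \<Rightarrow> bool" where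
  "has_conf_deriv \<alpha> g L t \<longleftrightarrow>
     (if t = 0
      then \<exists>G. (\<forall>\<^sub>F s in at_right 0. (conf_quotient \<alpha> g s \<longlongrightarrow> G s) (at 0)) \<and>
               (G \<longlongrightarrow> L) (at_right 0)
      else (conf_quotient \<alpha> g t \<longlongrightarrow> L) (at 0))"

definition is_solution ::
    "real \<Rightarrow> (real \<Rightarrow> 'z::real_normed_vector \<Rightarrow>\<^sub>L 'z) \<Rightarrow> (real \<Rightarrow> 'z) \<Rightarrow> bool" where
  "is_solution \<alpha> A x \<longleftrightarrow>
     continuous_on {0..} x \<and> (\<forall>t\<ge>0. has_conf_deriv \<alpha> x (blinfun_apply (A t) (x t)) t)"

(* For continuous A a solution on {0..} passes through every point (s, v), so the first clause alone
   determines U on {0..} x {0..} and the other two follow from it.  Invertibility,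
   U t s o U s t = Id, is contained in the last two clauses. *)
definition evolution_operators ::
    "real \<Rightarrow> (real \<Rightarrow> 'z::real_normed_vector \<Rightarrow>\<^sub>L 'z) \<Rightarrow> (real \<Rightarrow> real \<Rightarrow> 'z \<Rightarrow>\<^sub>L 'z) \<Rightarrow> bool" where
  "evolution_operators \<alpha> A U \<longleftrightarrow>
     (\<forall>x. is_solution \<alpha> A x \<longrightarrow> (\<forall>t\<ge>0. \<forall>s\<ge>0. x t = blinfun_apply (U t s) (x s))) \<and>
     (\<forall>t\<ge>0. U t t = id_blinfun) \<and>
     (\<forall>t\<ge>0. \<forall>s\<ge>0. \<forall>r\<ge>0. U t s o\<^sub>L U s r = U t r)"

definition mlE :: "real \<Rightarrow> real \<Rightarrow> real \<Rightarrow> real" where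
  "mlE \<alpha> c t = exp (c * t powr \<alpha> / \<alpha>)"

definition ml_dichotomy_with ::
    "real \<Rightarrow> (real \<Rightarrow> 'z::real_normed_vector \<Rightarrow>\<^sub>L 'z) \<Rightarrow>
     real \<Rightarrow> real \<Rightarrow> real \<Rightarrow> real \<Rightarrow> real \<Rightarrow> bool" where
  "ml_dichotomy_with \<alpha> A N1 N2 \<beta>1 \<beta>2 \<epsilon> \<longleftrightarrow>
     N1 > 0 \<and> N2 > 0 \<and> \<beta>1 > 0 \<and> \<beta>2 > 0 \<and> \<epsilon> \<ge> 0 \<and>
     (\<exists>U P. evolution_operators \<alpha> A U \<and>
        (\<forall>t\<ge>0. P t o\<^sub>L P t = P t) \<and>
        (\<forall>s\<ge>0. \<forall>t\<ge>s. U t s o\<^sub>L P s = P t o\<^sub>L U t s) \<and>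
        (\<forall>s\<ge>0. \<forall>t\<ge>s. norm (U t s o\<^sub>L P s) \<le> N1 * (mlE \<alpha> \<beta>1 s / mlE \<alpha> \<beta>1 t) * mlE \<alpha> \<epsilon> s) \<and>
        (\<forall>t\<ge>0. \<forall>s\<ge>t. norm (U t s o\<^sub>L (id_blinfun - P s))
                        \<le> N2 * (mlE \<alpha> \<beta>2 t / mlE \<alpha> \<beta>2 s) * mlE \<alpha> \<epsilon> s))"

definition admits_ml_dichotomy ::
    "real \<Rightarrow> (real \<Rightarrow> 'z::real_normed_vector \<Rightarrow>\<^sub>L 'z) \<Rightarrow> bool" where
  "admits_ml_dichotomy \<alpha> A \<longleftrightarrow> (\<exists>N1 N2 \<beta>1 \<beta>2 \<epsilon>. ml_dichotomy_with \<alpha> A N1 N2 \<beta>1 \<beta>2 \<epsilon>)"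

end

theory Submission imports Defs begin

text \<open>
  The substitution \<open>\<tau> = t\<^sup>\<alpha> / \<alpha>\<close> turns the conformable equation into the ordinary equation
  \<open>x' = A x\<close> on the half-line and the Mittag-Leffler dichotomy into a nonuniform exponential dichotomy.
  There, a fixed point of the Green operator yields the operator-valued bounded solution of the
  perturbed equation; its value at time 0, composed with the given projection, is a new projection with
  the same kernel. Variation of constants over \<open>[a, c]\<close> shows that the norm of any
  perturbed solution is dominated by two exponentials anchored at the end points. Letting
  \<open>c \<rightarrow> \<infinity>\<close> for bounded solutions, and taking \<open>a = 0\<close> for solutions
  starting in the kernel, gives the decay in both directions. The same formula bounds the unstable part
  of the former and the stable part of the latter by a small multiple of their norm, so the new
  projections stay comparable to the old ones.
\<close>

section \<open>Integrals and fixed points on the half-line\<close>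

lemma continuous_on_half_line_subset:
  fixes f :: "real \<Rightarrow> 'a::topological_space"
  assumes "continuous_on {0..} f" "0 \<le> a"
  shows "continuous_on {a..b} f"
  using assms by (auto intro: continuous_on_subset)

lemma norm_integral_le_decay_left:
  fixes f :: "real \<Rightarrow> 'a::banach"
  assumes f: "continuous_on {a..t} f" and "a \<le> t" and "0 < \<mu>" and "0 \<le> K"
    and bound: "\<And>s. a \<le> s \<Longrightarrow> s \<le> t \<Longrightarrow> norm (f s) \<le> K * exp (- \<mu> * (t - s))"
  shows "norm (integral {a..t} f) \<le> K / \<mu>"
proof -
  have I: "((\<lambda>s. K * exp (- \<mu> * (t - s))) has_integral
      K / \<mu> * exp (- \<mu> * (t - t)) - K / \<mu> * exp (- \<mu> * (t - a))) {a..t}"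
    using \<open>a \<le> t\<close> \<open>0 < \<mu>\<close>
    by (intro fundamental_theorem_of_calculus)
      (auto intro!: derivative_eq_intros simp flip: has_real_derivative_iff_has_vector_derivative)
  have "norm (integral {a..t} f) \<le> integral {a..t} (\<lambda>s. K * exp (- \<mu> * (t - s)))"
    using f bound I
    by (intro Henstock_Kurzweil_Integration.integral_norm_bound_integral integrable_continuous_real)
      (auto intro!: continuous_intros)
  also have "\<dots> = K / \<mu> * exp (- \<mu> * (t - t)) - K / \<mu> * exp (- \<mu> * (t - a))"
    using I by (rule integral_unique)
  also have "\<dots> \<le> K / \<mu>"
    using \<open>0 < \<mu>\<close> \<open>0 \<le> K\<close> by simp
  finally show ?thesis .
qed

lemma norm_integral_le_decay_right:
  fixes f :: "real \<Rightarrow> 'a::banach"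
  assumes f: "continuous_on {t..c} f" and "t \<le> c" and "0 < \<mu>" and "0 \<le> K"
    and bound: "\<And>s. t \<le> s \<Longrightarrow> s \<le> c \<Longrightarrow> norm (f s) \<le> K * exp (- \<mu> * (s - t))"
  shows "norm (integral {t..c} f) \<le> K / \<mu>"
proof -
  have I: "((\<lambda>s. K * exp (- \<mu> * (s - t))) has_integral
      - K / \<mu> * exp (- \<mu> * (c - t)) - (- K / \<mu> * exp (- \<mu> * (t - t)))) {t..c}"
    using \<open>t \<le> c\<close> \<open>0 < \<mu>\<close>
    by (intro fundamental_theorem_of_calculus)
      (auto intro!: derivative_eq_intros simp flip: has_real_derivative_iff_has_vector_derivative)
  have "norm (integral {t..c} f) \<le> integral {t..c} (\<lambda>s. K * exp (- \<mu> * (s - t)))"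
    using f bound I
    by (intro Henstock_Kurzweil_Integration.integral_norm_bound_integral integrable_continuous_real)
      (auto intro!: continuous_intros)
  also have "\<dots> = - K / \<mu> * exp (- \<mu> * (c - t)) - (- K / \<mu> * exp (- \<mu> * (t - t)))"
    using I by (rule integral_unique)
  also have "\<dots> \<le> K / \<mu>"
    using \<open>0 < \<mu>\<close> \<open>0 \<le> K\<close> by simp
  finally show ?thesis .
qed

lemma has_vector_derivative_integral_half_line:
  fixes f :: "real \<Rightarrow> 'a::banach"
  assumes f: "continuous_on {0..} f" and "0 < t"
  shows "((\<lambda>t. integral {0..t} f) has_vector_derivative f t) (at t)"
proof -
  have "((\<lambda>t. integral {0..t} f) has_vector_derivative f t) (at t within {0..t+1})"
    using \<open>0 < t\<close> continuous_on_half_line_subset[OF f]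
    by (intro integral_has_vector_derivative) auto
  moreover have "at t within {0..t+1} = at t"
    using \<open>0 < t\<close> by (intro at_within_interior) simp
  ultimately show ?thesis by simp
qed

lemma continuous_on_half_lineI:
  fixes f :: "real \<Rightarrow> 'a::topological_space"
  assumes "\<And>T. 0 < T \<Longrightarrow> continuous_on {0..T} f"
  shows "continuous_on {0..} f"
  unfolding continuous_on_eq_continuous_within
proof
  fix t :: real assume "t \<in> {0..}"
  then have "continuous (at t within {0..t+1}) f"
    using assms[of "t+1"] by (auto simp: continuous_on_eq_continuous_within)
  moreover have "at t within {0..} = at t within {0..t+1}"
    by (rule at_within_nhd[where S="{..<t+1}"]) auto
  ultimately show "continuous (at t within {0..}) f" by simp
qed

lemma continuous_on_integral_half_line:
  fixes f :: "real \<Rightarrow> 'a::banach"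
  assumes f: "continuous_on {0..} f"
  shows "continuous_on {0..} (\<lambda>t. integral {0..t} f)"
  using continuous_on_half_line_subset[OF f]
  by (intro continuous_on_half_lineI indefinite_integral_continuous_1 integrable_continuous_real) auto

lemma integral_half_line_diff:
  fixes f :: "real \<Rightarrow> 'a::banach"
  assumes f: "continuous_on {0..} f" and "0 \<le> a" "a \<le> t"
  shows "integral {0..t} f - integral {0..a} f = integral {a..t} f"
proof -
  have "f integrable_on {0..t}"
    using continuous_on_half_line_subset[OF f] by (intro integrable_continuous_real) auto
  from Henstock_Kurzweil_Integration.integral_combine[OF \<open>0 \<le> a\<close> \<open>a \<le> t\<close> this]
  show ?thesis by (simp add: algebra_simps)
qed

lemma weighted_fixed_point:
  fixes \<Phi> :: "(real \<Rightarrow> 'a::banach) \<Rightarrow> real \<Rightarrow> 'a"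
  assumes w: "continuous_on {0..} w" "\<And>t. 0 \<le> t \<Longrightarrow> 0 < w t" and c: "0 \<le> c" "c < 1"
    and cont: "\<And>x K. continuous_on {0..} x \<Longrightarrow> (\<And>t. 0 \<le> t \<Longrightarrow> norm (x t) \<le> K * w t) \<Longrightarrow>
      continuous_on {0..} (\<Phi> x)"
    and zero: "\<And>t. 0 \<le> t \<Longrightarrow> norm (\<Phi> (\<lambda>_. 0) t) \<le> K0 * w t"
    and contr: "\<And>x y K L M t. continuous_on {0..} x \<Longrightarrow> continuous_on {0..} y \<Longrightarrow>
      (\<And>t. 0 \<le> t \<Longrightarrow> norm (x t) \<le> K * w t) \<Longrightarrow> (\<And>t. 0 \<le> t \<Longrightarrow> norm (y t) \<le> L * w t) \<Longrightarrow>
      (\<And>t. 0 \<le> t \<Longrightarrow> norm (x t - y t) \<le> M * w t) \<Longrightarrow> 0 \<le> M \<Longrightarrow> 0 \<le> t \<Longrightarrow>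
      norm (\<Phi> x t - \<Phi> y t) \<le> c * M * w t"
  obtains x K where "continuous_on {0..} x" "\<And>t. 0 \<le> t \<Longrightarrow> norm (x t) \<le> K * w t"
    "\<And>t. 0 \<le> t \<Longrightarrow> \<Phi> x t = x t"
proof -
  define X where "X = (\<lambda>(u :: real \<Rightarrow>\<^sub>C 'a) t. w t *\<^sub>R apply_bcontfun u t)"
  define \<Psi> where "\<Psi> = (\<lambda>u. Bcontfun (\<lambda>t. \<Phi> (X u) (max t 0) /\<^sub>R w (max t 0)))"
  have contX: "continuous_on {0..} (X u)" for u
    unfolding X_def using w by (auto intro!: continuous_intros)
  have boundX: "norm (X u t) \<le> norm u * w t" if "0 \<le> t" for u t
    using norm_bounded[of u t] w(2)[OF that] by (simp add: X_def mult.commute mult_left_mono)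
  have diffX: "norm (X u t - X v t) \<le> dist u v * w t" if "0 \<le> t" for u v t
    using norm_bounded[of "u - v" t] w(2)[OF that]
    by (simp add: X_def mult.commute mult_left_mono dist_norm flip: scaleR_diff_right)
  have apply_\<Psi>: "apply_bcontfun (\<Psi> u) t = \<Phi> (X u) (max t 0) /\<^sub>R w (max t 0)" for u t
  proof -
    have "(\<lambda>t. \<Phi> (X u) (max t 0) /\<^sub>R w (max t 0)) \<in> bcontfun"
    proof (rule bcontfun_normI)
      have "continuous_on {0..} (\<lambda>t. \<Phi> (X u) t /\<^sub>R w t)"
        using w cont[OF contX boundX] by (intro continuous_intros) (auto simp: less_imp_neq less_imp_neq[symmetric])
      then show "continuous_on UNIV (\<lambda>t. \<Phi> (X u) (max t 0) /\<^sub>R w (max t 0))"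
        by (rule continuous_on_compose2) (auto intro!: continuous_intros)
    next
      fix t :: real
      let ?t = "max t 0"
      have "norm (\<Phi> (X u) ?t - \<Phi> (\<lambda>_. 0) ?t) \<le> c * norm u * w ?t"
        using contr[OF contX _ boundX, of "\<lambda>_. 0" 0 u "norm u" ?t] boundX by simp
      with zero[of ?t] have "norm (\<Phi> (X u) ?t) \<le> (c * norm u + K0) * w ?t"
        by (simp add: algebra_simps) (smt (verit, ccfv_SIG) norm_triangle_sub)
      then show "norm (\<Phi> (X u) ?t /\<^sub>R w ?t) \<le> c * norm u + K0"
        using w(2)[of ?t] by (simp add: field_simps)
    qed
    then show ?thesis
      by (simp add: \<Psi>_def Bcontfun_inverse)
  qed
  have "\<exists>!u. \<Psi> u = u"
  proof (rule banach_fix_type[OF c])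
    show "\<forall>u v. dist (\<Psi> u) (\<Psi> v) \<le> c * dist u v"
    proof (intro allI)
      fix u v
      have "norm (\<Psi> u - \<Psi> v) \<le> c * dist u v"
      proof (rule norm_bound)
        fix t :: real
        let ?t = "max t 0"
        have "norm (apply_bcontfun (\<Psi> u - \<Psi> v) t) = norm (\<Phi> (X u) ?t - \<Phi> (X v) ?t) / w ?t"
          using w(2)[of ?t] by (simp add: apply_\<Psi> divide_inverse mult.commute flip: scaleR_diff_right)
        moreover have "norm (\<Phi> (X u) ?t - \<Phi> (X v) ?t) \<le> c * dist u v * w ?t"
          using contr[OF contX contX boundX boundX diffX] by simp
        ultimately show "norm (apply_bcontfun (\<Psi> u - \<Psi> v) t) \<le> c * dist u v"
          using w(2)[of ?t] by (simp add: pos_divide_le_eq)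
      qed
      then show "dist (\<Psi> u) (\<Psi> v) \<le> c * dist u v"
        by (simp add: dist_norm)
    qed
  qed
  then obtain u where u: "\<Psi> u = u" by blast
  have "\<Phi> (X u) t = X u t" if "0 \<le> t" for t
    using arg_cong[OF u, of "\<lambda>u. w t *\<^sub>R apply_bcontfun u t"] w(2)[OF that] that
    by (simp add: apply_\<Psi> X_def)
  with that contX boundX show thesis by blast
qed

lemma gronwall_zero:
  fixes u k :: "real \<Rightarrow> real"
  assumes u: "continuous_on {0..} u" and k: "continuous_on {0..} k"
    and nonneg: "\<And>t. 0 \<le> t \<Longrightarrow> 0 \<le> k t"
    and le: "\<And>t. 0 \<le> t \<Longrightarrow> u t \<le> integral {0..t} (\<lambda>s. k s * u s)"
    and "0 \<le> t"
  shows "u t \<le> 0"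
proof -
  define g where "g t = integral {0..t} (\<lambda>s. k s * u s)" for t
  define p where "p t = integral {0..t} k" for t
  have cg: "continuous_on {0..} g" and cp: "continuous_on {0..} p"
    unfolding g_def p_def using u k by (intro continuous_on_integral_half_line continuous_intros; simp)+
  have dg: "(g has_vector_derivative k s * u s) (at s)" if "0 < s" for s
    unfolding g_def using u k that has_vector_derivative_integral_half_line[of "\<lambda>s. k s * u s" s]
    by (simp add: continuous_intros)
  have dp: "(p has_vector_derivative k s) (at s)" if "0 < s" for s
    unfolding p_def using has_vector_derivative_integral_half_line[OF k that] .
  have "g t * exp (- p t) \<le> g 0 * exp (- p 0)"
  proof (cases "t = 0")
    case False
    with \<open>0 \<le> t\<close> have "0 < t" by simp
    show ?thesis
    proof (rule DERIV_nonpos_imp_decreasing_open[of 0 t "\<lambda>t. g t * exp (- p t)"])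
      show "continuous_on {0..t} (\<lambda>t. g t * exp (- p t))"
        using continuous_on_half_line_subset[OF cg] continuous_on_half_line_subset[OF cp]
        by (intro continuous_intros) auto
      fix s assume "0 < s" "s < t"
      have "((\<lambda>t. g t * exp (- p t)) has_real_derivative (k s * (u s - g s)) * exp (- p s)) (at s)"
        using dg[OF \<open>0 < s\<close>] dp[OF \<open>0 < s\<close>]
        by (auto intro!: derivative_eq_intros
            simp: algebra_simps simp flip: has_real_derivative_iff_has_vector_derivative)
      moreover have "(k s * (u s - g s)) * exp (- p s) \<le> 0"
        using nonneg[of s] le[of s] \<open>0 < s\<close> by (simp add: mult_nonneg_nonpos g_def mult_nonpos_nonneg)
      ultimately show "\<exists>y. ((\<lambda>t. g t * exp (- p t)) has_real_derivative y) (at s) \<and> y \<le> 0"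
        by blast
    qed (use \<open>0 < t\<close> in auto)
  qed simp
  then have "g t \<le> 0" by (simp add: g_def mult_le_0_iff)
  with le[OF \<open>0 \<le> t\<close>] show ?thesis by (simp add: g_def)
qed

section \<open>Linear equations\<close>

text \<open>Only continuity is required at 0.\<close>

definition solves_ode :: "(real \<Rightarrow> 'a \<Rightarrow> 'a) \<Rightarrow> (real \<Rightarrow> 'a::real_normed_vector) \<Rightarrow> bool" where
  "solves_ode f y \<longleftrightarrow> continuous_on {0..} y \<and> (\<forall>t>0. (y has_vector_derivative f t (y t)) (at t))"

lemma has_integral_vector_derivative_half_line:
  fixes y :: "real \<Rightarrow> 'a::banach"
  assumes y: "continuous_on {0..} y" and y': "\<And>t. 0 < t \<Longrightarrow> (y has_vector_derivative y' t) (at t)"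
    and "0 \<le> a" "a \<le> b"
  shows "(y' has_integral y b - y a) {a..b}"
  using assms continuous_on_half_line_subset[OF y \<open>0 \<le> a\<close>]
  by (intro fundamental_theorem_of_calculus_interior) auto

lemma solves_ode_exists:
  fixes f :: "real \<Rightarrow> 'a::banach \<Rightarrow> 'a"
  assumes cont: "\<And>y. continuous_on {0..} y \<Longrightarrow> continuous_on {0..} (\<lambda>t. f t (y t))"
    and k: "continuous_on {0..} k"
    and lipschitz: "\<And>t x y. 0 \<le> t \<Longrightarrow> norm (f t x - f t y) \<le> k t * norm (x - y)"
  obtains y where "solves_ode f y" "y 0 = v"
proof -
  \<comment> \<open>With the weight \<open>exp (\<integral> k')\<close> the Picard operator contracts by the factor 1/2 on the whole half-line.\<close>
  define k' where "k' t = 2 * \<bar>k t\<bar> + norm (f t 0)" for t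
  have ck': "continuous_on {0..} k'"
    unfolding k'_def using k cont[of "\<lambda>_. 0"] by (auto intro!: continuous_intros)
  define p where "p t = integral {0..t} k'" for t
  define w where "w t = exp (p t)" for t
  define \<Phi> where "\<Phi> y t = v + integral {0..t} (\<lambda>s. f s (y s))" for y t
  have cp: "continuous_on {0..} p"
    unfolding p_def by (rule continuous_on_integral_half_line[OF ck'])
  have cw: "continuous_on {0..} w"
    unfolding w_def using cp by (auto intro: continuous_intros)
  have dp: "(p has_vector_derivative k' t) (at t)" if "0 < t" for t
    unfolding p_def using has_vector_derivative_integral_half_line[OF ck' that] .
  have dw: "(w has_vector_derivative k' t * w t) (at t)" if "0 < t" for t
    using dp[OF that] unfolding w_def
    by (auto intro!: derivative_eq_intros simp flip: has_real_derivative_iff_has_vector_derivative)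
  have p_nonneg: "0 \<le> p t" if "0 \<le> t" for t
    unfolding p_def k'_def using continuous_on_half_line_subset[OF ck'[unfolded k'_def]]
    by (intro integral_nonneg integrable_continuous_real) auto
  obtain y K where y: "continuous_on {0..} y" and fixpt: "\<And>t. 0 \<le> t \<Longrightarrow> \<Phi> y t = y t"
  proof (rule weighted_fixed_point[of w "1/2" \<Phi> "norm v + 1"])
    show "continuous_on {0..} (\<Phi> x)" if "continuous_on {0..} x" for x
      unfolding \<Phi>_def using continuous_on_integral_half_line[OF cont[OF that]]
      by (intro continuous_intros)
    show "norm (\<Phi> (\<lambda>_. 0) t) \<le> (norm v + 1) * w t" if "0 \<le> t" for t
    proof -
      have "norm (integral {0..t} (\<lambda>s. f s 0)) \<le> p t"
        unfolding p_def using continuous_on_half_line_subset[OF ck']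
          continuous_on_half_line_subset[OF cont[of "\<lambda>_. 0"]]
        by (intro Henstock_Kurzweil_Integration.integral_norm_bound_integral integrable_continuous_real)
          (auto simp: k'_def)
      then have "norm (\<Phi> (\<lambda>_. 0) t) \<le> norm v + p t"
        unfolding \<Phi>_def by (intro norm_triangle_le) simp
      also have "\<dots> \<le> norm v * w t + w t"
        using p_nonneg[OF that] order_trans[OF _ exp_ge_add_one_self[of "p t"], of "p t"]
        by (intro add_mono) (auto simp: w_def mult_le_cancel_left1)
      finally show ?thesis by (simp add: algebra_simps)
    qed
    show "norm (\<Phi> x t - \<Phi> y t) \<le> 1/2 * M * w t"
      if x: "continuous_on {0..} x" and y: "continuous_on {0..} y"
        and M: "\<And>t. 0 \<le> t \<Longrightarrow> norm (x t - y t) \<le> M * w t" "0 \<le> M" and "0 \<le> t" for x y M t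
    proof -
      have I: "((\<lambda>s. M / 2 * (k' s * w s)) has_integral M / 2 * (w t - w 0)) {0..t}"
        using has_integral_vector_derivative_half_line[OF cw dw, of 0 t] \<open>0 \<le> t\<close>
        by (intro has_integral_mult_right) auto
      have cxy: "continuous_on {0..t} (\<lambda>s. f s (x s))" "continuous_on {0..t} (\<lambda>s. f s (y s))"
        using continuous_on_half_line_subset[OF cont[OF x]] continuous_on_half_line_subset[OF cont[OF y]]
        by auto
      have "\<Phi> x t - \<Phi> y t = integral {0..t} (\<lambda>s. f s (x s) - f s (y s))"
        unfolding \<Phi>_def using cxy by (subst integral_diff) (auto intro!: integrable_continuous_real)
      also have "norm \<dots> \<le> integral {0..t} (\<lambda>s. M / 2 * (k' s * w s))"
      proof (rule Henstock_Kurzweil_Integration.integral_norm_bound_integral)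
        show "(\<lambda>s. f s (x s) - f s (y s)) integrable_on {0..t}"
          using cxy by (intro integrable_continuous_real continuous_intros)
        fix s assume "s \<in> {0..t}"
        then have "0 \<le> s" by simp
        have "norm (f s (x s) - f s (y s)) \<le> \<bar>k s\<bar> * norm (x s - y s)"
          using lipschitz[OF \<open>0 \<le> s\<close>, of "x s" "y s"] mult_right_mono[OF abs_ge_self[of "k s"], of "norm (x s - y s)"]
          by simp
        also have "\<dots> \<le> (k' s / 2) * (M * w s)"
          using M(1)[OF \<open>0 \<le> s\<close>] by (intro mult_mono) (auto simp: k'_def)
        finally show "norm (f s (x s) - f s (y s)) \<le> M / 2 * (k' s * w s)"
          by (simp add: algebra_simps)
      qed (use I in blast)
      also have "\<dots> = M / 2 * (w t - w 0)"
        using I by (rule integral_unique)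
      also have "\<dots> \<le> 1/2 * M * w t"
        using M(2) by (simp add: w_def algebra_simps)
      finally show ?thesis .
    qed
  qed (use cw in \<open>auto simp: w_def\<close>)
  have y_eq: "y t = v + integral {0..t} (\<lambda>s. f s (y s))" if "0 \<le> t" for t
    using fixpt[OF that] by (simp add: \<Phi>_def)
  show thesis
  proof
    show "y 0 = v" using y_eq[of 0] by simp
    have "(y has_vector_derivative f t (y t)) (at t)" if "0 < t" for t
    proof (rule has_vector_derivative_transform_within_open[where S="{0<..}"])
      show "((\<lambda>t. v + integral {0..t} (\<lambda>s. f s (y s))) has_vector_derivative f t (y t)) (at t)"
        using has_vector_derivative_integral_half_line[OF cont[OF y] that]
        by (auto intro!: derivative_eq_intros)
    qed (use that y_eq in auto)
    with y show "solves_ode f y" by (simp add: solves_ode_def)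
  qed
qed

lemma solves_ode_unique:
  fixes f :: "real \<Rightarrow> 'a::banach \<Rightarrow> 'a"
  assumes k: "continuous_on {0..} k"
    and lipschitz: "\<And>t x y. 0 \<le> t \<Longrightarrow> norm (f t x - f t y) \<le> k t * norm (x - y)"
    and y: "solves_ode f y" and z: "solves_ode f z" and "y 0 = z 0" and "0 \<le> t"
  shows "y t = z t"
proof -
  have c: "continuous_on {0..} y" "continuous_on {0..} z"
    using y z by (auto simp: solves_ode_def)
  have le: "norm (y t - z t) \<le> integral {0..t} (\<lambda>s. \<bar>k s\<bar> * norm (y s - z s))" if "0 \<le> t" for t
  proof -
    have "((\<lambda>s. f s (y s) - f s (z s)) has_integral (y t - z t) - (y 0 - z 0)) {0..t}"
      using y z that by (intro has_integral_vector_derivative_half_line)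
        (auto simp: solves_ode_def intro!: continuous_intros derivative_eq_intros)
    then have I: "((\<lambda>s. f s (y s) - f s (z s)) has_integral (y t - z t)) {0..t}"
      using \<open>y 0 = z 0\<close> by simp
    have "norm (integral {0..t} (\<lambda>s. f s (y s) - f s (z s))) \<le> integral {0..t} (\<lambda>s. \<bar>k s\<bar> * norm (y s - z s))"
    proof (rule Henstock_Kurzweil_Integration.integral_norm_bound_integral)
      show "(\<lambda>s. \<bar>k s\<bar> * norm (y s - z s)) integrable_on {0..t}"
        using c k by (intro integrable_continuous_real continuous_on_half_line_subset continuous_intros) auto
      show "norm (f s (y s) - f s (z s)) \<le> \<bar>k s\<bar> * norm (y s - z s)" if "s \<in> {0..t}" for s
        using lipschitz[of s "y s" "z s"] that
          mult_right_mono[OF abs_ge_self[of "k s"], of "norm (y s - z s)"] by simp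
    qed (use I in blast)
    with I show ?thesis by (simp add: integral_unique)
  qed
  have "norm (y t - z t) \<le> 0"
    using c k le \<open>0 \<le> t\<close> by (intro gronwall_zero[of _ "\<lambda>s. \<bar>k s\<bar>"]) (auto intro!: continuous_intros)
  then show ?thesis by simp
qed

lemma continuous_on_blinfun_compose [continuous_intros]:
  "continuous_on S f \<Longrightarrow> continuous_on S g \<Longrightarrow> continuous_on S (\<lambda>x. f x o\<^sub>L g x)"
  by (rule bounded_bilinear.continuous_on[OF bounded_bilinear_blinfun_compose])

lemmas blinfun_compose_simps =
  bounded_bilinear.add_left[OF bounded_bilinear_blinfun_compose]
  bounded_bilinear.add_right[OF bounded_bilinear_blinfun_compose]
  bounded_bilinear.diff_left[OF bounded_bilinear_blinfun_compose]
  bounded_bilinear.diff_right[OF bounded_bilinear_blinfun_compose]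
  bounded_bilinear.minus_left[OF bounded_bilinear_blinfun_compose]
  bounded_bilinear.minus_right[OF bounded_bilinear_blinfun_compose]

lemma has_vector_derivative_blinfun_compose:
  assumes "(f has_vector_derivative f') (at x within S)" "(g has_vector_derivative g') (at x within S)"
  shows "((\<lambda>x. f x o\<^sub>L g x) has_vector_derivative (f x o\<^sub>L g') + (f' o\<^sub>L g x)) (at x within S)"
  using bounded_bilinear.has_vector_derivative[OF bounded_bilinear_blinfun_compose assms] .

text \<open>\<open>W\<close> is the pointwise inverse of \<open>V\<close>, so that \<open>V t o\<^sub>L W s\<close> is the evolution operator.\<close>

definition fundamental_solution ::
    "(real \<Rightarrow> 'z::real_normed_vector \<Rightarrow>\<^sub>L 'z) \<Rightarrow> (real \<Rightarrow> 'z \<Rightarrow>\<^sub>L 'z) \<Rightarrow> (real \<Rightarrow> 'z \<Rightarrow>\<^sub>L 'z) \<Rightarrow> bool" where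
  "fundamental_solution C V W \<longleftrightarrow> solves_ode (\<lambda>t X. C t o\<^sub>L X) V \<and> solves_ode (\<lambda>t X. - (X o\<^sub>L C t)) W \<and>
     V 0 = id_blinfun \<and> W 0 = id_blinfun \<and>
     (\<forall>t\<ge>0. V t o\<^sub>L W t = id_blinfun) \<and> (\<forall>t\<ge>0. W t o\<^sub>L V t = id_blinfun)"

lemma id_blinfun_compose [simp]: "id_blinfun o\<^sub>L X = X" "X o\<^sub>L id_blinfun = X"
  by (auto intro: blinfun_eqI)

lemma blinfun_compose_assoc: "(X o\<^sub>L Y) o\<^sub>L Z = X o\<^sub>L (Y o\<^sub>L Z)"
  by (auto intro: blinfun_eqI)

lemma norm_blinfun_compose_left_diff: "norm ((C o\<^sub>L X) - (C o\<^sub>L Y)) \<le> norm C * norm (X - Y)"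
  using norm_blinfun_compose[of C "X - Y"] by (simp add: blinfun_compose_simps)

lemma norm_blinfun_compose_right_diff: "norm ((X o\<^sub>L C) - (Y o\<^sub>L C)) \<le> norm C * norm (X - Y)"
  using norm_blinfun_compose[of "X - Y" C] by (simp add: blinfun_compose_simps mult.commute)

lemma fundamental_solution_exists:
  fixes C :: "real \<Rightarrow> 'z::banach \<Rightarrow>\<^sub>L 'z"
  assumes C: "continuous_on {0..} C"
  obtains V W where "fundamental_solution C V W"
proof -
  have cn: "continuous_on {0..} (\<lambda>t. norm (C t))" "continuous_on {0..} (\<lambda>t. 2 * norm (C t))"
    using C by (auto intro: continuous_intros)
  have cont: "continuous_on {0..} (\<lambda>t. C t o\<^sub>L X t)" "continuous_on {0..} (\<lambda>t. - (X t o\<^sub>L C t))"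
    if X: "continuous_on {0..} X" for X :: "real \<Rightarrow> 'z \<Rightarrow>\<^sub>L 'z"
    by (intro continuous_intros C X)+
  have minus: "norm (- (X o\<^sub>L C t) - (- (Y o\<^sub>L C t))) \<le> norm (C t) * norm (X - Y)" for t X Y
    using norm_blinfun_compose_right_diff[of Y "C t" X] by (simp add: norm_minus_commute)
  obtain V where V: "solves_ode (\<lambda>t X. C t o\<^sub>L X) V" "V 0 = id_blinfun"
    by (rule solves_ode_exists[of "\<lambda>t X. C t o\<^sub>L X", OF cont(1) cn(1) norm_blinfun_compose_left_diff])
  obtain W where W: "solves_ode (\<lambda>t X. - (X o\<^sub>L C t)) W" "W 0 = id_blinfun"
    by (rule solves_ode_exists[of "\<lambda>t X. - (X o\<^sub>L C t)", OF cont(2) cn(1) minus])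
  have dV: "(V has_vector_derivative C t o\<^sub>L V t) (at t)" and dW: "(W has_vector_derivative - (W t o\<^sub>L C t)) (at t)"
    if "0 < t" for t using V W that by (auto simp: solves_ode_def)
  have cV: "continuous_on {0..} V" and cW: "continuous_on {0..} W"
    using V W by (auto simp: solves_ode_def)
  have sol_WV: "solves_ode (\<lambda>_ _. 0) (\<lambda>t. W t o\<^sub>L V t)"
    unfolding solves_ode_def
  proof (intro conjI allI impI)
    show "((\<lambda>t. W t o\<^sub>L V t) has_vector_derivative 0) (at t)" if "0 < t" for t
      using has_vector_derivative_blinfun_compose[OF dW dV, OF that that]
      by (simp add: blinfun_compose_simps blinfun_compose_assoc)
  qed (use cV cW in \<open>intro continuous_intros\<close>)
  have sol_id: "solves_ode (\<lambda>_ _. 0) (\<lambda>t. id_blinfun :: 'z \<Rightarrow>\<^sub>L 'z)"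
    by (auto simp: solves_ode_def intro!: continuous_intros derivative_eq_intros)
  have WV: "W t o\<^sub>L V t = id_blinfun" if "0 \<le> t" for t
    by (rule solves_ode_unique[of "\<lambda>_. 0", OF _ _ sol_WV sol_id _ that]) (auto simp: V W)
  have sol_VW: "solves_ode (\<lambda>t X. (C t o\<^sub>L X) - (X o\<^sub>L C t)) (\<lambda>t. V t o\<^sub>L W t)"
    unfolding solves_ode_def
  proof (intro conjI allI impI)
    show "((\<lambda>t. V t o\<^sub>L W t) has_vector_derivative (C t o\<^sub>L (V t o\<^sub>L W t)) - ((V t o\<^sub>L W t) o\<^sub>L C t)) (at t)"
      if "0 < t" for t
      using has_vector_derivative_blinfun_compose[OF dV dW, OF that that]
      by (simp add: blinfun_compose_simps blinfun_compose_assoc)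
  qed (use cV cW in \<open>intro continuous_intros\<close>)
  have sol_id': "solves_ode (\<lambda>t X. (C t o\<^sub>L X) - (X o\<^sub>L C t)) (\<lambda>t. id_blinfun :: 'z \<Rightarrow>\<^sub>L 'z)"
    by (auto simp: solves_ode_def intro!: continuous_intros derivative_eq_intros)
  have lipschitz: "norm (((C t o\<^sub>L X) - (X o\<^sub>L C t)) - ((C t o\<^sub>L Y) - (Y o\<^sub>L C t))) \<le> 2 * norm (C t) * norm (X - Y)" for t X Y
  proof -
    have "((C t o\<^sub>L X) - (X o\<^sub>L C t)) - ((C t o\<^sub>L Y) - (Y o\<^sub>L C t)) =
        ((C t o\<^sub>L X) - (C t o\<^sub>L Y)) - ((X o\<^sub>L C t) - (Y o\<^sub>L C t))" by simp
    also have "norm \<dots> \<le> norm ((C t o\<^sub>L X) - (C t o\<^sub>L Y)) + norm ((X o\<^sub>L C t) - (Y o\<^sub>L C t))"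
      by (rule norm_triangle_ineq4)
    also have "\<dots> \<le> norm (C t) * norm (X - Y) + norm (C t) * norm (X - Y)"
      by (intro add_mono norm_blinfun_compose_left_diff norm_blinfun_compose_right_diff)
    finally show ?thesis by simp
  qed
  have VW: "V t o\<^sub>L W t = id_blinfun" if "0 \<le> t" for t
    by (rule solves_ode_unique[OF cn(2) lipschitz sol_VW sol_id' _ that]) (auto simp: V W)
  show thesis
    by (rule that[of V W]) (simp add: fundamental_solution_def V W WV VW)
qed

lemma solves_ode_fundamental_solution_column:
  assumes "fundamental_solution C V W"
  shows "solves_ode (\<lambda>t. blinfun_apply (C t)) (\<lambda>t. V t v)"
proof -
  have "solves_ode (\<lambda>t X. C t o\<^sub>L X) V"
    using assms by (simp add: fundamental_solution_def)
  then show ?thesis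
    unfolding solves_ode_def
    by (auto intro!: continuous_intros bounded_linear.has_vector_derivative[OF blinfun.bounded_linear_left]
        simp flip: blinfun_apply_blinfun_compose)
qed

lemma fundamental_solution_apply:
  fixes C :: "real \<Rightarrow> 'z::banach \<Rightarrow>\<^sub>L 'z"
  assumes C: "continuous_on {0..} C" and VW: "fundamental_solution C V W"
    and y: "solves_ode (\<lambda>t. blinfun_apply (C t)) y" and "0 \<le> t" "0 \<le> s"
  shows "y t = (V t o\<^sub>L W s) (y s)"
proof -
  have V0: "V 0 = id_blinfun"
    using VW by (simp add: fundamental_solution_def)
  have eq: "y t = V t (y 0)" if "0 \<le> t" for t
  proof (rule solves_ode_unique[OF _ _ y solves_ode_fundamental_solution_column[OF VW] _ that])
    show "continuous_on {0..} (\<lambda>t. norm (C t))"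
      using C by (intro continuous_intros)
    show "norm (C t x - C t z) \<le> norm (C t) * norm (x - z)" for t x z
      by (metis blinfun.diff_right norm_blinfun)
  qed (simp add: V0)
  have "W s (V s (y 0)) = y 0"
    using VW \<open>0 \<le> s\<close> by (simp add: fundamental_solution_def flip: blinfun_apply_blinfun_compose)
  then show ?thesis
    using eq[OF \<open>0 \<le> t\<close>] eq[OF \<open>0 \<le> s\<close>] by simp
qed

section \<open>Robustness of exponential dichotomies\<close>

definition exp_dichotomy ::
    "(real \<Rightarrow> 'z::real_normed_vector \<Rightarrow>\<^sub>L 'z) \<Rightarrow> (real \<Rightarrow> 'z \<Rightarrow>\<^sub>L 'z) \<Rightarrow> 'z \<Rightarrow>\<^sub>L 'z \<Rightarrow>
     real \<Rightarrow> real \<Rightarrow> real \<Rightarrow> bool" where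
  "exp_dichotomy V W P N b \<epsilon> \<longleftrightarrow> P o\<^sub>L P = P \<and>
     (\<forall>s\<ge>0. \<forall>t\<ge>s. norm (V t o\<^sub>L (P o\<^sub>L W s)) \<le> N * exp (- b * (t - s) + \<epsilon> * s)) \<and>
     (\<forall>t\<ge>0. \<forall>s\<ge>t. norm (V t o\<^sub>L ((id_blinfun - P) o\<^sub>L W s)) \<le> N * exp (- b * (s - t) + \<epsilon> * s))"

lemma integral_blinfun_compose_left:
  fixes f :: "real \<Rightarrow> 'z::banach \<Rightarrow>\<^sub>L 'z"
  assumes "f integrable_on S"
  shows "integral S (\<lambda>s. K o\<^sub>L f s) = K o\<^sub>L integral S f"
  using integral_linear[OF assms bounded_bilinear.bounded_linear_right[OF bounded_bilinear_blinfun_compose]]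
  by (simp add: o_def)

locale perturbed_dichotomy =
  fixes A B V W V' W' :: "real \<Rightarrow> 'z::banach \<Rightarrow>\<^sub>L 'z" and P :: "'z \<Rightarrow>\<^sub>L 'z" and N b \<epsilon> \<delta> :: real
  assumes contA: "continuous_on {0..} A" and contB: "continuous_on {0..} B"
    and fundamental: "fundamental_solution A V W"
    and fundamental': "fundamental_solution (\<lambda>t. A t + B t) V' W'"
    and dichotomy: "exp_dichotomy V W P N b \<epsilon>"
    and N: "0 < N" and \<epsilon>: "0 \<le> \<epsilon>" "\<epsilon> < b" and \<delta>: "0 \<le> \<delta>"
    and normB: "\<And>t. 0 \<le> t \<Longrightarrow> norm (B t) \<le> \<delta> * exp (- 2 * \<epsilon> * t)"
    and small: "8 * \<delta> * N \<le> b - \<epsilon>" "8 * \<delta> * N\<^sup>2 \<le> b"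
begin

abbreviation "Q \<equiv> id_blinfun - P"
abbreviation sol :: "(real \<Rightarrow> 'z \<Rightarrow>\<^sub>L 'z) \<Rightarrow> bool" where
  "sol X \<equiv> solves_ode (\<lambda>t X. (A t + B t) o\<^sub>L X) X"
abbreviation f :: "(real \<Rightarrow> 'z \<Rightarrow>\<^sub>L 'z) \<Rightarrow> real \<Rightarrow> 'z \<Rightarrow>\<^sub>L 'z" where
  "f X t \<equiv> W t o\<^sub>L (B t o\<^sub>L X t)"
text \<open>The rate of the perturbed dichotomy: it must lie strictly between \<open>\<epsilon>\<close> and \<open>b\<close>.\<close>

definition b' where "b' = (b + \<epsilon>) / 2"

lemma b: "0 < b"
  using \<epsilon> by simp

lemma b': "\<epsilon> < b'" "b' < b" "0 < b'"
  using \<epsilon> by (auto simp: b'_def)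

lemma
  shows contV: "continuous_on {0..} V" and contW: "continuous_on {0..} W"
    and derivV: "\<And>t. 0 < t \<Longrightarrow> (V has_vector_derivative A t o\<^sub>L V t) (at t)"
    and derivW: "\<And>t. 0 < t \<Longrightarrow> (W has_vector_derivative - (W t o\<^sub>L A t)) (at t)"
    and V0 [simp]: "V 0 = id_blinfun" and W0 [simp]: "W 0 = id_blinfun"
    and VW: "\<And>t. 0 \<le> t \<Longrightarrow> V t o\<^sub>L W t = id_blinfun" and WV: "\<And>t. 0 \<le> t \<Longrightarrow> W t o\<^sub>L V t = id_blinfun"
    and solV': "sol V'" and V'0 [simp]: "V' 0 = id_blinfun"
    and VW': "\<And>t. 0 \<le> t \<Longrightarrow> V' t o\<^sub>L W' t = id_blinfun"
  using fundamental fundamental' by (auto simp: fundamental_solution_def solves_ode_def)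

lemma VW_assoc: "0 \<le> t \<Longrightarrow> V t o\<^sub>L (W t o\<^sub>L X) = X"
  using VW[of t] by (simp flip: blinfun_compose_assoc)

lemma
  shows P: "P o\<^sub>L P = P"
    and stable: "\<And>s t. 0 \<le> s \<Longrightarrow> s \<le> t \<Longrightarrow> norm (V t o\<^sub>L (P o\<^sub>L W s)) \<le> N * exp (- b * (t - s) + \<epsilon> * s)"
    and unstable: "\<And>s t. 0 \<le> t \<Longrightarrow> t \<le> s \<Longrightarrow> norm (V t o\<^sub>L (Q o\<^sub>L W s)) \<le> N * exp (- b * (s - t) + \<epsilon> * s)"
  using dichotomy by (auto simp: exp_dichotomy_def)

lemma norm_kernel:
  assumes "norm (V t o\<^sub>L (R o\<^sub>L W s)) \<le> N * exp (- b * r + \<epsilon> * s)" and "0 \<le> s"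
  shows "norm (V t o\<^sub>L (R o\<^sub>L f X s)) \<le> N * \<delta> * exp (- b * r) * exp (- \<epsilon> * s) * norm (X s)"
proof -
  have "V t o\<^sub>L (R o\<^sub>L f X s) = (V t o\<^sub>L (R o\<^sub>L W s)) o\<^sub>L (B s o\<^sub>L X s)"
    by (simp add: blinfun_compose_assoc)
  also have "norm \<dots> \<le> norm (V t o\<^sub>L (R o\<^sub>L W s)) * (norm (B s) * norm (X s))"
    by (rule order_trans[OF norm_blinfun_compose]) (intro mult_left_mono norm_blinfun_compose norm_ge_zero)
  also have "\<dots> \<le> (N * exp (- b * r + \<epsilon> * s)) * ((\<delta> * exp (- 2 * \<epsilon> * s)) * norm (X s))"
    using N \<delta> by (intro mult_mono assms normB) auto
  also have "\<dots> = N * \<delta> * exp (- b * r) * exp (- \<epsilon> * s) * norm (X s)"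
    by (simp add: algebra_simps flip: exp_add)
  finally show ?thesis .
qed

lemmas norm_kernel_stable = norm_kernel[OF stable]
lemmas norm_kernel_unstable = norm_kernel[OF unstable]

lemma sol_continuous: "sol X \<Longrightarrow> continuous_on {0..} X"
  by (simp add: solves_ode_def)

lemma continuous_on_f: "continuous_on {0..} X \<Longrightarrow> continuous_on {0..} (f X)"
  using contW contB by (intro continuous_intros)

lemma continuous_on_kernel:
  assumes "continuous_on {0..} X" "0 \<le> a"
  shows "continuous_on {a..t} (\<lambda>s. K o\<^sub>L (R o\<^sub>L f X s))"
  by (rule continuous_on_half_line_subset[OF _ assms(2)]) (intro continuous_intros contW contB assms(1))

lemma sol_compose: "sol X \<Longrightarrow> sol (\<lambda>t. X t o\<^sub>L K)"
  unfolding solves_ode_def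
  by (auto intro!: continuous_intros
      bounded_linear.has_vector_derivative[OF bounded_bilinear.bounded_linear_left[OF bounded_bilinear_blinfun_compose]]
      simp flip: blinfun_compose_assoc)

lemma sol_unique: "sol X \<Longrightarrow> 0 \<le> t \<Longrightarrow> X t = V' t o\<^sub>L X 0"
proof (rule solves_ode_unique[OF _ norm_blinfun_compose_left_diff _ sol_compose[OF solV']])
  show "continuous_on {0..} (\<lambda>t. norm (A t + B t))"
    using contA contB by (intro continuous_intros)
qed auto

lemma variation_of_constants:
  fixes K :: "'z \<Rightarrow>\<^sub>L 'z"
  assumes X: "sol X" and "0 \<le> a" "a \<le> t"
  shows "((\<lambda>s. K o\<^sub>L f X s) has_integral (K o\<^sub>L (W t o\<^sub>L X t)) - (K o\<^sub>L (W a o\<^sub>L X a))) {a..t}"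
proof (rule has_integral_vector_derivative_half_line[where y="\<lambda>s. K o\<^sub>L (W s o\<^sub>L X s)", OF _ _ assms(2,3)])
  show "continuous_on {0..} (\<lambda>s. K o\<^sub>L (W s o\<^sub>L X s))"
    using contW sol_continuous[OF X] by (intro continuous_intros)
  show "((\<lambda>s. K o\<^sub>L (W s o\<^sub>L X s)) has_vector_derivative K o\<^sub>L f X s) (at s)" if "0 < s" for s
  proof -
    have "(X has_vector_derivative (A s + B s) o\<^sub>L X s) (at s)"
      using X that by (simp add: solves_ode_def)
    from has_vector_derivative_blinfun_compose[OF derivW[OF that] this]
    have "((\<lambda>s. W s o\<^sub>L X s) has_vector_derivative f X s) (at s)"
      by (simp add: blinfun_compose_simps blinfun_compose_assoc)
    from bounded_linear.has_vector_derivative[OF bounded_bilinear.bounded_linear_right[OF bounded_bilinear_blinfun_compose] this]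
    show ?thesis .
  qed
qed

lemma sol_bound:
  assumes X: "sol X" and ac: "0 \<le> a" "a \<le> c"
    and p: "\<And>t. a \<le> t \<Longrightarrow> t \<le> c \<Longrightarrow> norm (V t o\<^sub>L (P o\<^sub>L (W a o\<^sub>L X a))) \<le> p * exp (- b * (t - a))"
    and q: "N * exp (\<epsilon> * c) * norm (X c) \<le> q" and pq: "0 \<le> p" "0 \<le> q" "0 < p + q"
    and t: "a \<le> t" "t \<le> c"
  shows "norm (X t) \<le> 2 * (p * exp (- b' * (t - a)) + q * exp (- b' * (c - t)))"
proof -
  define w where "w t = p * exp (- b' * (t - a)) + q * exp (- b' * (c - t))" for t
  have w: "0 < w t" for t
    using pq by (cases "p = 0") (auto simp: w_def intro: add_pos_nonneg)
  have w_le: "w s \<le> exp (b' * \<bar>t - s\<bar>) * w t" for s t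
  proof -
    have "b' * (t - s) \<le> b' * \<bar>t - s\<bar>" "b' * (s - t) \<le> b' * \<bar>t - s\<bar>"
      using b'(3) by (intro mult_left_mono; simp)+
    then have "- b' * (s - a) \<le> b' * \<bar>t - s\<bar> + - b' * (t - a)" "- b' * (c - s) \<le> b' * \<bar>t - s\<bar> + - b' * (c - t)"
      by (auto simp: algebra_simps)
    then have "exp (- b' * (s - a)) \<le> exp (b' * \<bar>t - s\<bar>) * exp (- b' * (t - a))"
      "exp (- b' * (c - s)) \<le> exp (b' * \<bar>t - s\<bar>) * exp (- b' * (c - t))"
      unfolding exp_add[symmetric] by auto
    from mult_left_mono[OF this(1) pq(1)] mult_left_mono[OF this(2) pq(2)] show ?thesis
      by (simp add: w_def algebra_simps)
  qed
  have cX: "continuous_on {0..} X" by (rule sol_continuous[OF X])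
  have "\<exists>m\<in>{a..c}. \<forall>s\<in>{a..c}. norm (X s) / w s \<le> norm (X m) / w m"
  proof (rule continuous_attains_sup)
    show "continuous_on {a..c} (\<lambda>s. norm (X s) / w s)"
      using continuous_on_half_line_subset[OF cX] ac w unfolding w_def
      by (intro continuous_intros) (auto simp: less_imp_neq[symmetric])
  qed (use ac in auto)
  then obtain m where m: "a \<le> m" "m \<le> c"
    and max: "\<And>s. a \<le> s \<Longrightarrow> s \<le> c \<Longrightarrow> norm (X s) / w s \<le> norm (X m) / w m" by auto
  \<comment> \<open>Inserting the bound \<open>norm (X s) \<le> M * w s\<close> into the variation of constants formula gives \<open>M \<le> 1 + M / 2\<close>.\<close>
  define M where "M = norm (X m) / w m"
  have M: "0 \<le> M" and XM: "\<And>s. a \<le> s \<Longrightarrow> s \<le> c \<Longrightarrow> norm (X s) \<le> M * w s"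
    using w max by (auto simp: M_def pos_divide_le_eq less_imp_le)
  have kernel: "norm (V m o\<^sub>L (R o\<^sub>L f X s)) \<le> N * \<delta> * M * w m * exp (- (b - b') * \<bar>m - s\<bar>)"
    if *: "norm (V m o\<^sub>L (R o\<^sub>L W s)) \<le> N * exp (- b * \<bar>m - s\<bar> + \<epsilon> * s)" and s: "a \<le> s" "s \<le> c" for R s
  proof -
    have "0 \<le> s" using ac s by simp
    have "norm (V m o\<^sub>L (R o\<^sub>L f X s)) \<le> N * \<delta> * exp (- b * \<bar>m - s\<bar>) * exp (- \<epsilon> * s) * norm (X s)"
      by (rule norm_kernel[OF * \<open>0 \<le> s\<close>])
    also have "\<dots> \<le> N * \<delta> * exp (- b * \<bar>m - s\<bar>) * 1 * (M * (exp (b' * \<bar>m - s\<bar>) * w m))"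
      using N \<delta> \<epsilon> \<open>0 \<le> s\<close> order_trans[OF XM[OF s] mult_left_mono[OF w_le M]]
      by (intro mult_mono mult_nonneg_nonneg) auto
    also have "\<dots> = N * \<delta> * M * w m * (exp (- b * \<bar>m - s\<bar>) * exp (b' * \<bar>m - s\<bar>))"
      by (simp only: mult_ac mult_1)
    also have "exp (- b * \<bar>m - s\<bar>) * exp (b' * \<bar>m - s\<bar>) = exp (- (b - b') * \<bar>m - s\<bar>)"
      unfolding exp_add[symmetric] by (rule arg_cong[where f=exp]) (simp add: algebra_simps)
    finally show ?thesis .
  qed
  have pos: "0 \<le> N * \<delta> * M * w m" "0 < b - b'"
    using N \<delta> M w[of m] b' by auto
  have I1: "norm ((V m o\<^sub>L (P o\<^sub>L (W m o\<^sub>L X m))) - (V m o\<^sub>L (P o\<^sub>L (W a o\<^sub>L X a)))) \<le> N * \<delta> * M * w m / (b - b')"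
  proof -
    have "((\<lambda>s. V m o\<^sub>L (P o\<^sub>L f X s)) has_integral (V m o\<^sub>L (P o\<^sub>L (W m o\<^sub>L X m))) - (V m o\<^sub>L (P o\<^sub>L (W a o\<^sub>L X a)))) {a..m}"
      using variation_of_constants[OF X ac(1) m(1), of "V m o\<^sub>L P"] by (simp add: blinfun_compose_assoc)
    moreover have "norm (integral {a..m} (\<lambda>s. V m o\<^sub>L (P o\<^sub>L f X s))) \<le> N * \<delta> * M * w m / (b - b')"
    proof (rule norm_integral_le_decay_left[OF continuous_on_kernel[OF cX ac(1)] m(1) pos(2,1)])
      show "norm (V m o\<^sub>L (P o\<^sub>L f X s)) \<le> N * \<delta> * M * w m * exp (- (b - b') * (m - s))" if "a \<le> s" "s \<le> m" for s
        using kernel[of P s] stable[of s m] that ac m by (simp add: abs_of_nonneg)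
    qed
    ultimately show ?thesis by (simp add: integral_unique)
  qed
  have I2: "norm ((V m o\<^sub>L (Q o\<^sub>L (W c o\<^sub>L X c))) - (V m o\<^sub>L (Q o\<^sub>L (W m o\<^sub>L X m)))) \<le> N * \<delta> * M * w m / (b - b')"
  proof -
    have "((\<lambda>s. V m o\<^sub>L (Q o\<^sub>L f X s)) has_integral (V m o\<^sub>L (Q o\<^sub>L (W c o\<^sub>L X c))) - (V m o\<^sub>L (Q o\<^sub>L (W m o\<^sub>L X m)))) {m..c}"
      using variation_of_constants[OF X _ m(2), of "V m o\<^sub>L Q"] ac m by (simp add: blinfun_compose_assoc)
    moreover have "norm (integral {m..c} (\<lambda>s. V m o\<^sub>L (Q o\<^sub>L f X s))) \<le> N * \<delta> * M * w m / (b - b')"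
    proof (rule norm_integral_le_decay_right[OF continuous_on_kernel[OF cX] m(2) pos(2,1)])
      show "0 \<le> m" using ac m by simp
      show "norm (V m o\<^sub>L (Q o\<^sub>L f X s)) \<le> N * \<delta> * M * w m * exp (- (b - b') * (s - m))" if "m \<le> s" "s \<le> c" for s
        using kernel[of Q s] unstable[of m s] that ac m by (simp add: abs_of_nonpos)
    qed
    ultimately show ?thesis by (simp add: integral_unique)
  qed
  have E1: "norm (V m o\<^sub>L (P o\<^sub>L (W a o\<^sub>L X a))) \<le> p * exp (- b' * (m - a))"
  proof -
    have "exp (- b * (m - a)) \<le> exp (- b' * (m - a))"
      using b' m by (simp add: mult_right_mono)
    from mult_left_mono[OF this pq(1)] p[OF m] show ?thesis by linarith
  qed
  have E2: "norm (V m o\<^sub>L (Q o\<^sub>L (W c o\<^sub>L X c))) \<le> q * exp (- b' * (c - m))"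
  proof -
    have "norm (V m o\<^sub>L (Q o\<^sub>L (W c o\<^sub>L X c))) = norm ((V m o\<^sub>L (Q o\<^sub>L W c)) o\<^sub>L X c)"
      by (simp add: blinfun_compose_assoc)
    also have "\<dots> \<le> N * exp (- b * (c - m) + \<epsilon> * c) * norm (X c)"
      using unstable[of m c] ac m
      by (intro order_trans[OF norm_blinfun_compose mult_right_mono]) auto
    also have "\<dots> = (N * exp (\<epsilon> * c) * norm (X c)) * exp (- b * (c - m))"
      by (simp only: exp_add mult_ac)
    also have "\<dots> \<le> q * exp (- b' * (c - m))"
      using q pq b' m by (intro mult_mono) (auto simp: mult_right_mono)
    finally show ?thesis .
  qed
  have "(V m o\<^sub>L (P o\<^sub>L (W m o\<^sub>L X m))) + (V m o\<^sub>L (Q o\<^sub>L (W m o\<^sub>L X m))) = X m"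
    using ac m by (simp add: blinfun_compose_simps VW_assoc)
  then have "X m = ((V m o\<^sub>L (P o\<^sub>L (W m o\<^sub>L X m))) - (V m o\<^sub>L (P o\<^sub>L (W a o\<^sub>L X a)))) + (V m o\<^sub>L (P o\<^sub>L (W a o\<^sub>L X a)))
      - (((V m o\<^sub>L (Q o\<^sub>L (W c o\<^sub>L X c))) - (V m o\<^sub>L (Q o\<^sub>L (W m o\<^sub>L X m)))) - (V m o\<^sub>L (Q o\<^sub>L (W c o\<^sub>L X c))))"
    by (simp add: algebra_simps)
  also have "norm \<dots> \<le> (N * \<delta> * M * w m / (b - b') + p * exp (- b' * (m - a)))
      + (N * \<delta> * M * w m / (b - b') + q * exp (- b' * (c - m)))"
    by (intro norm_triangle_le_diff add_mono norm_triangle_le I1 I2 E1 E2)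
  also have "\<dots> = w m * (1 + M * (4 * \<delta> * N / (b - \<epsilon>)))"
  proof -
    define k where "k = N * \<delta> * M / (b - \<epsilon>)"
    have "b - b' = (b - \<epsilon>) / 2" by (simp add: b'_def field_simps)
    then have k1: "N * \<delta> * M * w m / (b - b') = 2 * k * w m"
      unfolding k_def by (simp only:) simp
    have k2: "M * (4 * \<delta> * N / (b - \<epsilon>)) = 4 * k"
      by (simp add: k_def)
    have "w m = p * exp (- b' * (m - a)) + q * exp (- b' * (c - m))"
      by (simp only: w_def)
    then show ?thesis
      unfolding k1 k2 by (simp add: algebra_simps)
  qed
  also have "\<dots> \<le> w m * (1 + M * (1 / 2))"
    using small(1) \<epsilon> M w[of m] by (intro mult_left_mono add_left_mono) (auto simp: field_simps)
  finally have "M \<le> 1 + M * (1 / 2)"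
    using w[of m] by (simp add: M_def pos_divide_le_eq mult.commute)
  then have "M \<le> 2" by simp
  have "norm (X t) \<le> M * w t" by (rule XM[OF t])
  also have "\<dots> \<le> 2 * w t"
    using \<open>M \<le> 2\<close> w[of t] by (intro mult_right_mono) auto
  finally show ?thesis by (simp only: w_def)
qed

lemma bounded_sol_decay:
  assumes X: "sol X" and M: "\<And>t. 0 \<le> t \<Longrightarrow> norm (X t) \<le> M" and "0 \<le> a" "a \<le> t"
  shows "norm (X t) \<le> 2 * N * exp (\<epsilon> * a) * norm (X a) * exp (- b' * (t - a))"
proof -
  define p where "p = N * exp (\<epsilon> * a) * norm (X a)"
  define q where "q c = N * exp (\<epsilon> * c) * (\<bar>M\<bar> + 1)" for c
  have p: "norm (V s o\<^sub>L (P o\<^sub>L (W a o\<^sub>L X a))) \<le> p * exp (- b * (s - a))" if "a \<le> s" for s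
  proof -
    have "norm (V s o\<^sub>L (P o\<^sub>L (W a o\<^sub>L X a))) = norm ((V s o\<^sub>L (P o\<^sub>L W a)) o\<^sub>L X a)"
      by (simp add: blinfun_compose_assoc)
    also have "\<dots> \<le> N * exp (- b * (s - a) + \<epsilon> * a) * norm (X a)"
      using stable[of a s] \<open>0 \<le> a\<close> that
      by (intro order_trans[OF norm_blinfun_compose mult_right_mono]) auto
    also have "\<dots> = p * exp (- b * (s - a))"
      by (simp only: p_def exp_add mult_ac)
    finally show ?thesis .
  qed
  have "norm (X t) \<le> 2 * (p * exp (- b' * (t - a)) + q c * exp (- b' * (c - t)))" if "t \<le> c" for c
  proof (rule sol_bound[OF X \<open>0 \<le> a\<close>])
    have "norm (X c) \<le> \<bar>M\<bar> + 1"
      using M[of c] \<open>0 \<le> a\<close> \<open>a \<le> t\<close> that by simp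
    then show "N * exp (\<epsilon> * c) * norm (X c) \<le> q c"
      unfolding q_def using N by (intro mult_left_mono) auto
    have "0 < q c"
      unfolding q_def using N by (intro mult_pos_pos) auto
    moreover show "0 \<le> p"
      using N by (simp add: p_def)
    ultimately show "0 \<le> q c" "0 < p + q c" by auto
  qed (use p \<open>a \<le> t\<close> that in auto)
  then have ev: "\<forall>\<^sub>F c in at_top. norm (X t) \<le> 2 * (p * exp (- b' * (t - a)) + q c * exp (- b' * (c - t)))"
    using eventually_ge_at_top by (rule eventually_mono[rotated])
  have lim: "((\<lambda>c. 2 * (p * exp (- b' * (t - a)) + q c * exp (- b' * (c - t)))) \<longlongrightarrow>
      2 * (p * exp (- b' * (t - a)) + 0)) at_top"
  proof (intro tendsto_mult_left tendsto_add tendsto_const)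
    have "filterlim (\<lambda>c. (\<epsilon> - b') * c) at_bot at_top"
      using b' by (intro filterlim_tendsto_neg_mult_at_bot[OF tendsto_const] filterlim_ident) auto
    then have "((\<lambda>c. N * (\<bar>M\<bar> + 1) * exp (b' * t) * exp ((\<epsilon> - b') * c)) \<longlongrightarrow>
        N * (\<bar>M\<bar> + 1) * exp (b' * t) * 0) at_top"
      by (intro tendsto_mult_left filterlim_compose[OF exp_at_bot])
    then show "((\<lambda>c. q c * exp (- b' * (c - t))) \<longlongrightarrow> 0) at_top"
      by (simp add: q_def algebra_simps flip: exp_add)
  qed
  have "norm (X t) \<le> 2 * (p * exp (- b' * (t - a)) + 0)"
    by (rule tendsto_lowerbound[OF lim ev]) simp
  then show ?thesis by (simp add: p_def)
qed

lemma unstable_sol_decay: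
  assumes X: "sol X" and X0: "P o\<^sub>L X 0 = 0" and "0 \<le> t" "t \<le> c"
  shows "norm (X t) \<le> 2 * N * exp (\<epsilon> * c) * norm (X c) * exp (- b' * (c - t))"
proof (rule field_le_epsilon)
  fix e :: real assume "0 < e"
  have "norm (X t) \<le> 2 * (e / 2 * exp (- b' * (t - 0)) + (N * exp (\<epsilon> * c) * norm (X c)) * exp (- b' * (c - t)))"
    using X0 N \<open>0 < e\<close> assms(3,4)
    by (intro sol_bound[OF X]) (auto intro!: add_pos_nonneg)
  moreover have "e * exp (- b' * t) \<le> e"
    using b' \<open>0 < e\<close> \<open>0 \<le> t\<close> by simp
  ultimately show "norm (X t) \<le> 2 * N * exp (\<epsilon> * c) * norm (X c) * exp (- b' * (c - t)) + e"
    by (simp add: algebra_simps)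
qed

lemma bounded_sol_unstable_part:
  assumes X: "sol X" and M: "\<And>t. 0 \<le> t \<Longrightarrow> norm (X t) \<le> M" and "0 \<le> a"
  shows "norm (V a o\<^sub>L (Q o\<^sub>L (W a o\<^sub>L X a))) \<le> 2 * N\<^sup>2 * \<delta> / b * norm (X a)"
proof -
  let ?K = "2 * N\<^sup>2 * \<delta> * norm (X a)"
  have bound: "norm (V a o\<^sub>L (Q o\<^sub>L (W a o\<^sub>L X a))) \<le> N * exp (- b * (c - a) + \<epsilon> * c) * M + ?K / b" if "a \<le> c" for c
  proof -
    have "0 \<le> c" using \<open>0 \<le> a\<close> that by simp
    have "((\<lambda>s. V a o\<^sub>L (Q o\<^sub>L f X s)) has_integral (V a o\<^sub>L (Q o\<^sub>L (W c o\<^sub>L X c))) - (V a o\<^sub>L (Q o\<^sub>L (W a o\<^sub>L X a)))) {a..c}"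
      using variation_of_constants[OF X \<open>0 \<le> a\<close> that, of "V a o\<^sub>L Q"] by (simp add: blinfun_compose_assoc)
    then have "integral {a..c} (\<lambda>s. V a o\<^sub>L (Q o\<^sub>L f X s)) = (V a o\<^sub>L (Q o\<^sub>L (W c o\<^sub>L X c))) - (V a o\<^sub>L (Q o\<^sub>L (W a o\<^sub>L X a)))"
      by (rule integral_unique)
    moreover have "norm (integral {a..c} (\<lambda>s. V a o\<^sub>L (Q o\<^sub>L f X s))) \<le> ?K / b"
    proof (rule norm_integral_le_decay_right[OF continuous_on_kernel[OF sol_continuous[OF X] \<open>0 \<le> a\<close>] that b])
      fix s assume s: "a \<le> s" "s \<le> c"
      have "norm (V a o\<^sub>L (Q o\<^sub>L f X s)) \<le> N * \<delta> * exp (- b * (s - a)) * exp (- \<epsilon> * s) * norm (X s)"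
        using s \<open>0 \<le> a\<close> by (intro norm_kernel_unstable) auto
      also have "\<dots> \<le> N * \<delta> * exp (- b * (s - a)) * exp (- \<epsilon> * s) * (2 * N * exp (\<epsilon> * a) * norm (X a) * exp (- b' * (s - a)))"
        using N \<delta> s \<open>0 \<le> a\<close> by (intro mult_left_mono bounded_sol_decay[OF X M]) auto
      also have "\<dots> = ?K * exp (- b * (s - a)) * (exp (- \<epsilon> * s) * exp (\<epsilon> * a) * exp (- b' * (s - a)))"
        by (simp add: power2_eq_square)
      also have "\<dots> \<le> ?K * exp (- b * (s - a)) * 1"
      proof (intro mult_left_mono)
        have "\<epsilon> * a \<le> \<epsilon> * s" "0 \<le> b' * (s - a)"
          using \<epsilon> b' s by (auto intro: mult_left_mono)
        then show "exp (- \<epsilon> * s) * exp (\<epsilon> * a) * exp (- b' * (s - a)) \<le> 1"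
          unfolding exp_add[symmetric] by simp
      qed (use \<delta> in auto)
      finally show "norm (V a o\<^sub>L (Q o\<^sub>L f X s)) \<le> ?K * exp (- b * (s - a))" by simp
    qed (use \<delta> in auto)
    moreover have "norm (V a o\<^sub>L (Q o\<^sub>L (W c o\<^sub>L X c))) \<le> N * exp (- b * (c - a) + \<epsilon> * c) * M"
    proof -
      have "norm ((V a o\<^sub>L (Q o\<^sub>L W c)) o\<^sub>L X c) \<le> norm (V a o\<^sub>L (Q o\<^sub>L W c)) * norm (X c)"
        by (rule norm_blinfun_compose)
      also have "\<dots> \<le> N * exp (- b * (c - a) + \<epsilon> * c) * M"
        using unstable[OF \<open>0 \<le> a\<close> that] M[OF \<open>0 \<le> c\<close>] N by (intro mult_mono) auto
      finally show ?thesis by (simp add: blinfun_compose_assoc)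
    qed
    ultimately show ?thesis
      using norm_triangle_ineq4[of "V a o\<^sub>L (Q o\<^sub>L (W c o\<^sub>L X c))" "integral {a..c} (\<lambda>s. V a o\<^sub>L (Q o\<^sub>L f X s))"] by simp
  qed
  have ev: "\<forall>\<^sub>F c in at_top. norm (V a o\<^sub>L (Q o\<^sub>L (W a o\<^sub>L X a))) \<le> N * exp (- b * (c - a) + \<epsilon> * c) * M + ?K / b"
    using bound eventually_ge_at_top by (rule eventually_mono[rotated])
  have lim: "((\<lambda>c. N * exp (- b * (c - a) + \<epsilon> * c) * M + ?K / b) \<longlongrightarrow> 0 + ?K / b) at_top"
  proof (intro tendsto_add tendsto_const)
    have "filterlim (\<lambda>c. (\<epsilon> - b) * c) at_bot at_top"
      using \<epsilon> by (intro filterlim_tendsto_neg_mult_at_bot[OF tendsto_const] filterlim_ident) auto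
    then have "((\<lambda>c. N * M * exp (b * a) * exp ((\<epsilon> - b) * c)) \<longlongrightarrow> N * M * exp (b * a) * 0) at_top"
      by (intro tendsto_mult_left filterlim_compose[OF exp_at_bot])
    then show "((\<lambda>c. N * exp (- b * (c - a) + \<epsilon> * c) * M) \<longlongrightarrow> 0) at_top"
      by (simp add: algebra_simps flip: exp_add)
  qed
  have "norm (V a o\<^sub>L (Q o\<^sub>L (W a o\<^sub>L X a))) \<le> 0 + ?K / b"
    by (rule tendsto_lowerbound[OF lim ev]) simp
  then show ?thesis by simp
qed

lemma unstable_sol_stable_part:
  assumes X: "sol X" and X0: "P o\<^sub>L X 0 = 0" and "0 \<le> c"
  shows "norm (V c o\<^sub>L (P o\<^sub>L (W c o\<^sub>L X c))) \<le> 2 * N\<^sup>2 * \<delta> / b * norm (X c)"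
proof -
  let ?K = "2 * N\<^sup>2 * \<delta> * norm (X c)"
  have "((\<lambda>s. V c o\<^sub>L (P o\<^sub>L f X s)) has_integral V c o\<^sub>L (P o\<^sub>L (W c o\<^sub>L X c))) {0..c}"
    using variation_of_constants[OF X order_refl \<open>0 \<le> c\<close>, of "V c o\<^sub>L P"] X0 by (simp add: blinfun_compose_assoc)
  then have "integral {0..c} (\<lambda>s. V c o\<^sub>L (P o\<^sub>L f X s)) = V c o\<^sub>L (P o\<^sub>L (W c o\<^sub>L X c))"
    by (rule integral_unique)
  moreover have "norm (integral {0..c} (\<lambda>s. V c o\<^sub>L (P o\<^sub>L f X s))) \<le> ?K / b"
  proof (rule norm_integral_le_decay_left[OF continuous_on_kernel[OF sol_continuous[OF X] order_refl] \<open>0 \<le> c\<close> b])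
    fix s assume s: "0 \<le> s" "s \<le> c"
    have "norm (V c o\<^sub>L (P o\<^sub>L f X s)) \<le> N * \<delta> * exp (- b * (c - s)) * exp (- \<epsilon> * s) * norm (X s)"
      using s by (intro norm_kernel_stable) auto
    also have "\<dots> \<le> N * \<delta> * exp (- b * (c - s)) * exp (- \<epsilon> * s) * (2 * N * exp (\<epsilon> * c) * norm (X c) * exp (- b' * (c - s)))"
      using N \<delta> s by (intro mult_left_mono unstable_sol_decay[OF X X0]) auto
    also have "\<dots> = ?K * exp (- b * (c - s)) * (exp (- \<epsilon> * s) * exp (\<epsilon> * c) * exp (- b' * (c - s)))"
      by (simp add: power2_eq_square)
    also have "\<dots> \<le> ?K * exp (- b * (c - s)) * 1"
    proof (intro mult_left_mono)
      have "\<epsilon> * (c - s) \<le> b' * (c - s)"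
        using b' s by (intro mult_right_mono) auto
      then show "exp (- \<epsilon> * s) * exp (\<epsilon> * c) * exp (- b' * (c - s)) \<le> 1"
        unfolding exp_add[symmetric] by (simp add: algebra_simps)
    qed (use \<delta> in auto)
    finally show "norm (V c o\<^sub>L (P o\<^sub>L f X s)) \<le> ?K * exp (- b * (c - s))" by simp
  qed (use \<delta> in auto)
  ultimately show ?thesis by simp
qed


lemma tail_convergent:
  assumes X: "continuous_on {0..} X" and M: "\<And>t. 0 \<le> t \<Longrightarrow> norm (X t) \<le> M" "0 \<le> M"
  shows "convergent (\<lambda>n. integral {0..real n} (\<lambda>s. Q o\<^sub>L f X s))" (is "convergent ?F")
proof -
  let ?K = "N * \<delta> * M"
  have cQ: "continuous_on {0..} (\<lambda>s. Q o\<^sub>L f X s)"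
    by (intro continuous_intros contW contB X)
  have dist: "dist (?F m) (?F n) \<le> ?K / b * exp (- b * real m)" if "m < n" for m n
  proof -
    have "norm (integral {real m..real n} (\<lambda>s. Q o\<^sub>L f X s)) \<le> ?K * exp (- b * real m) / b"
    proof (rule norm_integral_le_decay_right[OF continuous_on_half_line_subset[OF cQ] _ b])
      fix s assume s: "real m \<le> s" "s \<le> real n"
      have "0 \<le> s" using s(1) by (rule order_trans[rotated]) simp
      have "norm (Q o\<^sub>L f X s) \<le> N * \<delta> * exp (- b * (s - 0)) * exp (- \<epsilon> * s) * norm (X s)"
        using norm_kernel_unstable[of 0 s X] \<open>0 \<le> s\<close> by simp
      also have "\<dots> \<le> N * \<delta> * exp (- b * (s - 0)) * 1 * M"
        using N \<delta> \<epsilon> M \<open>0 \<le> s\<close> by (intro mult_mono) auto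
      also have "exp (- b * (s - 0)) = exp (- b * real m) * exp (- b * (s - real m))"
        unfolding exp_add[symmetric] by (simp add: algebra_simps)
      finally show "norm (Q o\<^sub>L f X s) \<le> ?K * exp (- b * real m) * exp (- b * (s - real m))"
        by (simp only: mult_ac mult_1)
    qed (use that N \<delta> M in auto)
    then show ?thesis
      using integral_half_line_diff[OF cQ, of "real m" "real n"] that
      by (subst dist_commute) (simp add: dist_norm)
  qed
  have "(\<lambda>m. ?K / b * exp (- b * real m)) \<longlonglongrightarrow> ?K / b * 0"
  proof (intro tendsto_mult_left filterlim_compose[OF exp_at_bot])
    show "filterlim (\<lambda>m. - b * real m) at_bot sequentially"
      using b by (intro filterlim_tendsto_neg_mult_at_bot[OF tendsto_const] filterlim_real_sequentially) auto
  qed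
  then have lim: "(\<lambda>m. ?K / b * exp (- b * real m)) \<longlonglongrightarrow> 0" by simp
  have "Cauchy ?F"
    unfolding Cauchy_altdef
  proof (intro allI impI)
    fix e :: real assume "0 < e"
    from order_tendstoD(2)[OF lim this] obtain k where k: "\<And>m. k \<le> m \<Longrightarrow> ?K / b * exp (- b * real m) < e"
      unfolding eventually_sequentially by auto
    show "\<exists>k. \<forall>m\<ge>k. \<forall>n>m. dist (?F m) (?F n) < e"
      by (intro exI[of _ k] allI impI) (rule order_le_less_trans[OF dist k])
  qed
  then show ?thesis by (simp add: Cauchy_convergent_iff)
qed

definition "tail X = lim (\<lambda>n. integral {0..real n} (\<lambda>s. Q o\<^sub>L f X s))"

text \<open>\<open>green X\<close> is the bounded solution of \<open>Y' = A Y + B X\<close> with \<open>P Y(0) = 0\<close>; the subtracted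
  \<open>tail X\<close> is the improper integral over \<open>[0, \<infinity>)\<close> of the unstable part.\<close>

definition "green X t = V t o\<^sub>L (integral {0..t} (f X) - tail X)"

lemma tail_LIMSEQ:
  assumes "continuous_on {0..} X" "\<And>t. 0 \<le> t \<Longrightarrow> norm (X t) \<le> M" "0 \<le> M"
  shows "(\<lambda>n. integral {0..real n} (\<lambda>s. Q o\<^sub>L f X s)) \<longlonglongrightarrow> tail X"
  using tail_convergent[OF assms] by (simp add: tail_def convergent_LIMSEQ_iff)

lemma f_integrable:
  assumes "continuous_on {0..} X" "0 \<le> a"
  shows "f X integrable_on {a..t}"
  by (rule integrable_continuous_real, rule continuous_on_half_line_subset[OF _ assms(2)])
    (intro continuous_intros contW contB assms(1))

lemma norm_green:
  assumes X: "continuous_on {0..} X" and M: "\<And>t. 0 \<le> t \<Longrightarrow> norm (X t) \<le> M" "0 \<le> M" and "0 \<le> t"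
  shows "norm (green X t) \<le> M / 2"
proof -
  let ?K = "N * \<delta> * M"
  have cQ: "continuous_on {0..} (\<lambda>s. Q o\<^sub>L f X s)"
    by (intro continuous_intros contW contB X)
  have kernel: "N * \<delta> * exp (- b * r) * exp (- \<epsilon> * s) * norm (X s) \<le> ?K * exp (- b * r)" if "0 \<le> s" for r s
  proof -
    have "N * \<delta> * exp (- b * r) * exp (- \<epsilon> * s) * norm (X s) \<le> N * \<delta> * exp (- b * r) * 1 * M"
      using N \<delta> \<epsilon> M that by (intro mult_mono) auto
    then show ?thesis by (simp add: mult_ac)
  qed
  have S: "norm (V t o\<^sub>L (P o\<^sub>L integral {0..t} (f X))) \<le> ?K / b"
  proof -
    have "norm (integral {0..t} (\<lambda>s. V t o\<^sub>L (P o\<^sub>L f X s))) \<le> ?K / b"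
    proof (rule norm_integral_le_decay_left[OF continuous_on_kernel[OF X order_refl] \<open>0 \<le> t\<close> b])
      show "norm (V t o\<^sub>L (P o\<^sub>L f X s)) \<le> ?K * exp (- b * (t - s))" if "0 \<le> s" "s \<le> t" for s
        using norm_kernel_stable[OF that that(1)] kernel[OF that(1)] by (rule order_trans)
    qed (use N \<delta> M in auto)
    moreover have "integral {0..t} (\<lambda>s. (V t o\<^sub>L P) o\<^sub>L f X s) = (V t o\<^sub>L P) o\<^sub>L integral {0..t} (f X)"
      by (rule integral_blinfun_compose_left[OF f_integrable[OF X order_refl]])
    ultimately show ?thesis by (simp add: blinfun_compose_assoc)
  qed
  have U: "norm (V t o\<^sub>L (tail X - (Q o\<^sub>L integral {0..t} (f X)))) \<le> ?K / b"
  proof (rule tendsto_upperbound)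
    have "(\<lambda>n. V t o\<^sub>L (integral {0..real n} (\<lambda>s. Q o\<^sub>L f X s) - (Q o\<^sub>L integral {0..t} (f X))))
        \<longlonglongrightarrow> (V t o\<^sub>L (tail X - (Q o\<^sub>L integral {0..t} (f X))))"
      by (intro bounded_bilinear.tendsto[OF bounded_bilinear_blinfun_compose] tendsto_intros tail_LIMSEQ[OF X M])
    then show "(\<lambda>n. norm (V t o\<^sub>L (integral {0..real n} (\<lambda>s. Q o\<^sub>L f X s) - (Q o\<^sub>L integral {0..t} (f X)))))
        \<longlonglongrightarrow> norm (V t o\<^sub>L (tail X - (Q o\<^sub>L integral {0..t} (f X))))"
      by (rule tendsto_norm)
    have "norm (V t o\<^sub>L (integral {0..real n} (\<lambda>s. Q o\<^sub>L f X s) - (Q o\<^sub>L integral {0..t} (f X)))) \<le> ?K / b"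
      if "t \<le> real n" for n
    proof -
      have "norm (integral {t..real n} (\<lambda>s. V t o\<^sub>L (Q o\<^sub>L f X s))) \<le> ?K / b"
      proof (rule norm_integral_le_decay_right[OF continuous_on_kernel[OF X \<open>0 \<le> t\<close>] that b])
        show "norm (V t o\<^sub>L (Q o\<^sub>L f X s)) \<le> ?K * exp (- b * (s - t))" if "t \<le> s" for s
        proof -
          have "0 \<le> s" using \<open>0 \<le> t\<close> that by simp
          show ?thesis
            using norm_kernel_unstable[OF \<open>0 \<le> t\<close> that \<open>0 \<le> s\<close>] kernel[OF \<open>0 \<le> s\<close>] by (rule order_trans)
        qed
      qed (use N \<delta> M in auto)
      moreover have "integral {t..real n} (\<lambda>s. V t o\<^sub>L (Q o\<^sub>L f X s)) = V t o\<^sub>L integral {t..real n} (\<lambda>s. Q o\<^sub>L f X s)"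
        using continuous_on_half_line_subset[OF cQ \<open>0 \<le> t\<close>]
        by (intro integral_blinfun_compose_left integrable_continuous_real)
      moreover have "integral {0..real n} (\<lambda>s. Q o\<^sub>L f X s) - (Q o\<^sub>L integral {0..t} (f X)) = integral {t..real n} (\<lambda>s. Q o\<^sub>L f X s)"
        using integral_half_line_diff[OF cQ \<open>0 \<le> t\<close> that]
        by (simp add: integral_blinfun_compose_left f_integrable[OF X])
      ultimately show ?thesis by simp
    qed
    then show "\<forall>\<^sub>F n in sequentially. norm (V t o\<^sub>L (integral {0..real n} (\<lambda>s. Q o\<^sub>L f X s) - (Q o\<^sub>L integral {0..t} (f X)))) \<le> ?K / b"
      using eventually_ge_at_top[of "nat \<lceil>t\<rceil>"] by (rule eventually_mono[rotated]) linarith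
  qed simp
  have green_eq: "green X t = (V t o\<^sub>L (P o\<^sub>L integral {0..t} (f X))) - (V t o\<^sub>L (tail X - (Q o\<^sub>L integral {0..t} (f X))))"
    by (simp add: green_def blinfun_compose_simps)
  have "norm (green X t) \<le> ?K / b + ?K / b"
    unfolding green_eq by (rule order_trans[OF norm_triangle_ineq4 add_mono[OF S U]])
  also have "\<dots> \<le> M / 2"
  proof -
    have "4 * \<delta> * N \<le> 8 * \<delta> * N" using N \<delta> by simp
    then have "M * (4 * \<delta> * N) \<le> M * b"
      using small(1) \<epsilon> M(2) by (intro mult_left_mono) auto
    then show ?thesis using b by (simp add: field_simps)
  qed
  finally show ?thesis .
qed

lemma green_diff:
  assumes X: "continuous_on {0..} X" "\<And>t. 0 \<le> t \<Longrightarrow> norm (X t) \<le> K" "0 \<le> K"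
    and Y: "continuous_on {0..} Y" "\<And>t. 0 \<le> t \<Longrightarrow> norm (Y t) \<le> L" "0 \<le> L"
  shows "green X t - green Y t = green (\<lambda>t. X t - Y t) t"
proof -
  have fd: "f (\<lambda>t. X t - Y t) = (\<lambda>s. f X s - f Y s)"
    by (simp add: blinfun_compose_simps fun_eq_iff)
  have integral_f: "integral {0..r} (\<lambda>s. R o\<^sub>L f (\<lambda>t. X t - Y t) s) =
      integral {0..r} (\<lambda>s. R o\<^sub>L f X s) - integral {0..r} (\<lambda>s. R o\<^sub>L f Y s)" for r and R :: "'z \<Rightarrow>\<^sub>L 'z"
  proof -
    have "integral {0..r} (\<lambda>s. (R o\<^sub>L f X s) - (R o\<^sub>L f Y s)) =
        integral {0..r} (\<lambda>s. R o\<^sub>L f X s) - integral {0..r} (\<lambda>s. R o\<^sub>L f Y s)"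
      using integrable_continuous_real[OF continuous_on_kernel[OF X(1) order_refl, of r id_blinfun R]]
        integrable_continuous_real[OF continuous_on_kernel[OF Y(1) order_refl, of r id_blinfun R]]
      by (intro Henstock_Kurzweil_Integration.integral_diff) simp_all
    then show ?thesis by (simp add: blinfun_compose_simps)
  qed
  have "(\<lambda>n. integral {0..real n} (\<lambda>s. Q o\<^sub>L f (\<lambda>t. X t - Y t) s)) \<longlonglongrightarrow> tail X - tail Y"
    unfolding integral_f by (intro tendsto_diff tail_LIMSEQ[OF X] tail_LIMSEQ[OF Y])
  then have "tail (\<lambda>t. X t - Y t) = tail X - tail Y"
    unfolding tail_def by (rule limI)
  then show ?thesis
    using integral_f[of t id_blinfun] by (simp add: green_def blinfun_compose_simps)
qed

lemma continuous_on_green: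
  assumes X: "continuous_on {0..} X"
  shows "continuous_on {0..} (green X)"
  unfolding green_def
  by (intro continuous_on_blinfun_compose contV continuous_on_diff continuous_on_const
      continuous_on_integral_half_line continuous_on_f X)

lemma bounded_solution_exists:
  obtains X M where "sol X" "\<And>t. 0 \<le> t \<Longrightarrow> norm (X t) \<le> M" "P o\<^sub>L X 0 = P"
proof -
  define \<Phi> where "\<Phi> X t = (V t o\<^sub>L P) + green X t" for X t
  have normP: "norm (V t o\<^sub>L P) \<le> N" if "0 \<le> t" for t
  proof -
    have "norm (V t o\<^sub>L P) \<le> N * exp (- b * t)"
      using stable[of 0 t] that by simp
    also have "\<dots> \<le> N * 1"
      using N b that by (intro mult_left_mono) auto
    finally show ?thesis by simp
  qed
  obtain X K where X: "continuous_on {0..} X" "\<And>t. 0 \<le> t \<Longrightarrow> norm (X t) \<le> K * 1"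
    and fixpt: "\<And>t. 0 \<le> t \<Longrightarrow> \<Phi> X t = X t"
  proof (rule weighted_fixed_point[of "\<lambda>_. 1" "1/2" \<Phi> N])
    show "continuous_on {0..} (\<Phi> X)" if "continuous_on {0..} X" for X
      unfolding \<Phi>_def by (intro continuous_intros contV continuous_on_green that)
    show "norm (\<Phi> (\<lambda>_. 0) t) \<le> N * 1" if "0 \<le> t" for t
      using normP[OF that] norm_green[of "\<lambda>_. 0" 0 t] that by (simp add: \<Phi>_def)
    show "norm (\<Phi> X t - \<Phi> Y t) \<le> 1/2 * M * 1"
      if X: "continuous_on {0..} X" "\<And>t. 0 \<le> t \<Longrightarrow> norm (X t) \<le> K * 1"
        and Y: "continuous_on {0..} Y" "\<And>t. 0 \<le> t \<Longrightarrow> norm (Y t) \<le> L * 1"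
        and M: "\<And>t. 0 \<le> t \<Longrightarrow> norm (X t - Y t) \<le> M * 1" "0 \<le> M" and t: "0 \<le> t" for X Y K L M t
    proof -
      have "0 \<le> K" "0 \<le> L"
        using order_trans[OF norm_ge_zero X(2)[of 0]] order_trans[OF norm_ge_zero Y(2)[of 0]] by auto
      then have "\<Phi> X t - \<Phi> Y t = green (\<lambda>t. X t - Y t) t"
        using green_diff[of X K Y L t] X Y by (simp add: \<Phi>_def)
      also have "norm \<dots> \<le> M / 2"
        using X(1) Y(1) M t by (intro norm_green continuous_intros) auto
      finally show ?thesis by simp
    qed
  qed auto
  have "0 \<le> K"
    using order_trans[OF norm_ge_zero X(2)[of 0]] by simp
  have X': "(X has_vector_derivative (A t + B t) o\<^sub>L X t) (at t)" if "0 < t" for t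
  proof (rule has_vector_derivative_transform_within_open[where S="{0<..}"])
    define Y where "Y t = P + (integral {0..t} (f X) - tail X)" for t
    have VY: "V t o\<^sub>L Y t = X t" if "0 \<le> t" for t
      using fixpt[OF that] by (simp add: Y_def \<Phi>_def green_def blinfun_compose_simps)
    show "V t o\<^sub>L Y t = X t" if "t \<in> {0<..}" for t
      using VY that by simp
    have "(Y has_vector_derivative f X t) (at t)"
      unfolding Y_def using has_vector_derivative_integral_half_line[OF continuous_on_f[OF X(1)] that]
      by (auto intro!: derivative_eq_intros)
    from has_vector_derivative_blinfun_compose[OF derivV[OF that] this]
    show "((\<lambda>t. V t o\<^sub>L Y t) has_vector_derivative (A t + B t) o\<^sub>L X t) (at t)"
      using VY[of t] that by (simp add: blinfun_compose_simps blinfun_compose_assoc VW_assoc add.commute)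
  qed (use that in auto)
  have PQ: "P o\<^sub>L (Q o\<^sub>L Y) = 0" for Y
    by (simp add: blinfun_compose_simps P flip: blinfun_compose_assoc)
  have "P o\<^sub>L tail X = 0"
  proof (rule LIMSEQ_unique)
    show "(\<lambda>n. P o\<^sub>L integral {0..real n} (\<lambda>s. Q o\<^sub>L f X s)) \<longlonglongrightarrow> (P o\<^sub>L tail X)"
      using X(2) \<open>0 \<le> K\<close>
      by (intro bounded_bilinear.tendsto[OF bounded_bilinear_blinfun_compose] tendsto_const tail_LIMSEQ[OF X(1), of K]) auto
    show "(\<lambda>n. P o\<^sub>L integral {0..real n} (\<lambda>s. Q o\<^sub>L f X s)) \<longlonglongrightarrow> 0"
      by (simp add: integral_blinfun_compose_left f_integrable[OF X(1)] PQ)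
  qed
  moreover have "X 0 = P - tail X"
    using fixpt[of 0] by (simp add: \<Phi>_def green_def)
  ultimately have "P o\<^sub>L X 0 = P"
    by (simp add: blinfun_compose_simps P)
  with that[of X K] X X' show thesis
    by (simp add: solves_ode_def)
qed

lemma dichotomy':
  obtains P' where "exp_dichotomy V' W' P' (4 * N\<^sup>2) b' (2 * \<epsilon>)"
proof -
  obtain X M where X: "sol X" "\<And>t. 0 \<le> t \<Longrightarrow> norm (X t) \<le> M" and PX: "P o\<^sub>L X 0 = P"
    using bounded_solution_exists by blast
  define P' where "P' = X 0 o\<^sub>L P"
  have PP': "P o\<^sub>L P' = P"
    by (simp add: P'_def PX P flip: blinfun_compose_assoc)
  have P': "P' o\<^sub>L P' = P'"
    using PP' by (simp add: P'_def blinfun_compose_assoc)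
  have V'P': "V' t o\<^sub>L P' = X t o\<^sub>L P" if "0 \<le> t" for t
    using sol_unique[OF X(1) that] by (simp add: P'_def flip: blinfun_compose_assoc)
  define S where "S a t = V' t o\<^sub>L (P' o\<^sub>L W' a)" for a t
  define U where "U c t = V' t o\<^sub>L ((id_blinfun - P') o\<^sub>L W' c)" for c t
  have solS: "sol (S a)" and solU: "sol (U c)" for a c
    unfolding S_def U_def by (intro sol_compose solV')+
  have boundS: "norm (S a t) \<le> M * norm (P o\<^sub>L W' a)" if "0 \<le> t" for a t
  proof -
    have "S a t = X t o\<^sub>L (P o\<^sub>L W' a)"
      using V'P'[OF that] by (simp add: S_def flip: blinfun_compose_assoc)
    then show ?thesis
      using norm_blinfun_compose[of "X t" "P o\<^sub>L W' a"] mult_right_mono[OF X(2)[OF that] norm_ge_zero[of "P o\<^sub>L W' a"]]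
      by simp
  qed
  have U0: "P o\<^sub>L U c 0 = 0" for c
    by (simp add: U_def blinfun_compose_simps PP' flip: blinfun_compose_assoc)
  have at: "norm (S a a) \<le> 2 * N * exp (\<epsilon> * a)" "norm (U a a) \<le> 2 * N * exp (\<epsilon> * a)" if "0 \<le> a" for a
  proof -
    have SU: "S a a + U a a = id_blinfun"
      using VW'[OF that] by (simp add: S_def U_def blinfun_compose_simps)
    define p where "p = V a o\<^sub>L (P o\<^sub>L W a)"
    define q where "q = V a o\<^sub>L (Q o\<^sub>L W a)"
    have pq: "p + q = id_blinfun"
      using VW[OF that] by (simp add: p_def q_def blinfun_compose_simps)
    have np: "norm p \<le> N * exp (\<epsilon> * a)" and nq: "norm q \<le> N * exp (\<epsilon> * a)"
      using stable[of a a] unstable[of a a] that by (auto simp: p_def q_def)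
    have "U a a = id_blinfun - S a a" "q = id_blinfun - p"
      using SU pq by (auto simp: algebra_simps)
    then have D: "S a a - p = (q o\<^sub>L S a a) - (p o\<^sub>L U a a)" and D': "U a a - q = p - S a a"
      by (auto simp: blinfun_compose_simps)
    have "norm (q o\<^sub>L S a a) \<le> 2 * N\<^sup>2 * \<delta> / b * norm (S a a)" "norm (p o\<^sub>L U a a) \<le> 2 * N\<^sup>2 * \<delta> / b * norm (U a a)"
      using bounded_sol_unstable_part[OF solS boundS that] unstable_sol_stable_part[OF solU U0 that]
      by (simp_all add: p_def q_def blinfun_compose_assoc)
    moreover have "2 * N\<^sup>2 * \<delta> / b \<le> 1 / 4"
      using small(2) b by (simp add: field_simps)
    then have "2 * N\<^sup>2 * \<delta> / b * norm Y \<le> 1 / 4 * norm Y" for Y :: "'z \<Rightarrow>\<^sub>L 'z"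
      by (intro mult_right_mono) auto
    ultimately have "norm (q o\<^sub>L S a a) \<le> 1 / 4 * norm (S a a)" "norm (p o\<^sub>L U a a) \<le> 1 / 4 * norm (U a a)"
      using order_trans by blast+
    then have "norm (S a a - p) \<le> 1 / 4 * norm (S a a) + 1 / 4 * norm (U a a)"
      unfolding D by (intro order_trans[OF norm_triangle_ineq4] add_mono)
    moreover have "norm (S a a) \<le> norm p + norm (S a a - p)"
      by (rule norm_triangle_sub)
    moreover have "norm (U a a) \<le> norm q + norm (S a a - p)"
      using norm_triangle_sub[of "U a a" q] D' by (simp add: norm_minus_commute)
    ultimately show "norm (S a a) \<le> 2 * N * exp (\<epsilon> * a)" "norm (U a a) \<le> 2 * N * exp (\<epsilon> * a)"
      using np nq by linarith+
  qed
  have combine: "y \<le> 4 * N\<^sup>2 * exp (- b' * r + 2 * \<epsilon> * a)"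
    if y: "y \<le> 2 * N * exp (\<epsilon> * a) * x * exp (- b' * r)" and x: "x \<le> 2 * N * exp (\<epsilon> * a)" for x y r a
  proof -
    note y
    also have "2 * N * exp (\<epsilon> * a) * x * exp (- b' * r) \<le>
        2 * N * exp (\<epsilon> * a) * (2 * N * exp (\<epsilon> * a)) * exp (- b' * r)"
      using N by (intro mult_right_mono mult_left_mono x) auto
    also have "\<dots> = 4 * N\<^sup>2 * (exp (- b' * r) * exp (\<epsilon> * a) * exp (\<epsilon> * a))"
      by (simp add: power2_eq_square)
    also have "\<dots> = 4 * N\<^sup>2 * exp (- b' * r + 2 * \<epsilon> * a)"
      unfolding exp_add[symmetric] by (simp add: algebra_simps)
    finally show ?thesis .
  qed
  have "exp_dichotomy V' W' P' (4 * N\<^sup>2) b' (2 * \<epsilon>)"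
    unfolding exp_dichotomy_def
  proof (intro conjI allI impI)
    show "norm (V' t o\<^sub>L (P' o\<^sub>L W' s)) \<le> 4 * N\<^sup>2 * exp (- b' * (t - s) + 2 * \<epsilon> * s)" if "0 \<le> s" "s \<le> t" for s t
      using combine[OF bounded_sol_decay[OF solS boundS that] at(1)[OF that(1)]] by (simp add: S_def)
    show "norm (V' t o\<^sub>L ((id_blinfun - P') o\<^sub>L W' s)) \<le> 4 * N\<^sup>2 * exp (- b' * (s - t) + 2 * \<epsilon> * s)"
      if "0 \<le> t" "t \<le> s" for s t
      using combine[OF unstable_sol_decay[OF solU U0 that] at(2)] that by (simp add: U_def)
  qed (rule P')
  then show thesis by (rule that)
qed


end

section \<open>The conformable time scale\<close>

lemma has_vector_derivative_iff_quotient: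
  "(f has_vector_derivative L) (at x) \<longleftrightarrow> ((\<lambda>d. (f (x + d) - f x) /\<^sub>R d) \<longlongrightarrow> L) (at 0)"
proof -
  have "norm (f (x + d) - f x - d *\<^sub>R L) / norm d = norm ((f (x + d) - f x) /\<^sub>R d - L)" if "d \<noteq> 0" for d
  proof -
    have "(f (x + d) - f x) /\<^sub>R d - L = (f (x + d) - f x - d *\<^sub>R L) /\<^sub>R d"
      using that by (simp add: scaleR_diff_right)
    then show ?thesis by (simp add: divide_inverse mult.commute)
  qed
  then have "((\<lambda>d. norm (f (x + d) - f x - d *\<^sub>R L) / norm d) \<longlongrightarrow> 0) (at 0) \<longleftrightarrow>
      ((\<lambda>d. norm ((f (x + d) - f x) /\<^sub>R d - L)) \<longlongrightarrow> 0) (at 0)"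
    by (intro tendsto_cong) (auto simp: eventually_at_filter)
  then show ?thesis
    by (simp add: has_vector_derivative_def has_derivative_at bounded_linear_scaleR_left tendsto_norm_zero_iff LIM_zero_iff)
qed

lemma filterlim_mult_at_0:
  fixes c :: real
  assumes "c \<noteq> 0"
  shows "filterlim (\<lambda>e. e * c) (at 0) (at 0)"
proof (rule filterlim_atI)
  show "((\<lambda>e. e * c) \<longlongrightarrow> 0) (at 0)"
    by (intro tendsto_mult_left_zero tendsto_ident_at)
  show "\<forall>\<^sub>F e in at 0. e * c \<noteq> 0"
    using assms by (auto simp: eventually_at_filter)
qed

lemma conf_quotient_tendsto_iff:
  assumes "0 < t"
  shows "(conf_quotient \<alpha> x t \<longlongrightarrow> L) (at 0) \<longleftrightarrow>
    (x has_vector_derivative (t powr (\<alpha> - 1)) *\<^sub>R L) (at t)"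
proof -
  define k where "k = t powr (1 - \<alpha>)"
  define q where "q d = (x (t + d) - x t) /\<^sub>R d" for d
  have k: "0 < k" and k': "t powr (\<alpha> - 1) = inverse k"
    using assms by (auto simp: k_def simp flip: powr_minus)
  have cq: "conf_quotient \<alpha> x t e = k *\<^sub>R q (e * k)" for e
    using assms k by (simp add: conf_quotient_def q_def k_def)
  have qc: "q d = inverse k *\<^sub>R conf_quotient \<alpha> x t (d * inverse k)" for d
    using k by (simp add: cq mult.assoc)
  have "(conf_quotient \<alpha> x t \<longlongrightarrow> L) (at 0) \<longleftrightarrow> (q \<longlongrightarrow> inverse k *\<^sub>R L) (at 0)"
  proof
    assume "(conf_quotient \<alpha> x t \<longlongrightarrow> L) (at 0)"
    from filterlim_compose[OF this filterlim_mult_at_0[of "inverse k"]]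
    show "(q \<longlongrightarrow> inverse k *\<^sub>R L) (at 0)"
      unfolding qc using k by (intro tendsto_scaleR tendsto_const) auto
  next
    assume "(q \<longlongrightarrow> inverse k *\<^sub>R L) (at 0)"
    from filterlim_compose[OF this filterlim_mult_at_0[of k]]
    have "((\<lambda>e. k *\<^sub>R q (e * k)) \<longlongrightarrow> k *\<^sub>R (inverse k *\<^sub>R L)) (at 0)"
      using k by (intro tendsto_scaleR tendsto_const) auto
    then show "(conf_quotient \<alpha> x t \<longlongrightarrow> L) (at 0)"
      using k by (simp add: cq[abs_def])
  qed
  then show ?thesis
    by (simp add: has_vector_derivative_iff_quotient k' q_def[abs_def])
qed

definition conf_time :: "real \<Rightarrow> real \<Rightarrow> real" where
  "conf_time \<alpha> t = t powr \<alpha> / \<alpha>"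

definition conf_time_inv :: "real \<Rightarrow> real \<Rightarrow> real" where
  "conf_time_inv \<alpha> \<tau> = (\<alpha> * \<tau>) powr (1 / \<alpha>)"

lemma mlE_conf_time: "mlE \<alpha> c t = exp (c * conf_time \<alpha> t)"
  by (simp add: mlE_def conf_time_def)

context
  fixes \<alpha> :: real
  assumes \<alpha>: "0 < \<alpha>"
begin

lemma conf_time_nonneg [simp]: "0 \<le> conf_time \<alpha> t"
  using \<alpha> by (simp add: conf_time_def)

lemma conf_time_inv_nonneg [simp]: "0 \<le> conf_time_inv \<alpha> \<tau>"
  by (simp add: conf_time_inv_def)

lemma conf_time_inverse [simp]:
  "0 \<le> t \<Longrightarrow> conf_time_inv \<alpha> (conf_time \<alpha> t) = t"
  "0 \<le> \<tau> \<Longrightarrow> conf_time \<alpha> (conf_time_inv \<alpha> \<tau>) = \<tau>"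
  using \<alpha> by (auto simp: conf_time_def conf_time_inv_def powr_powr)

lemma conf_time_mono: "0 \<le> s \<Longrightarrow> s \<le> t \<Longrightarrow> conf_time \<alpha> s \<le> conf_time \<alpha> t"
  using \<alpha> by (auto simp: conf_time_def intro!: divide_right_mono powr_mono2)

lemma conf_time_inv_mono: "0 \<le> \<sigma> \<Longrightarrow> \<sigma> \<le> \<tau> \<Longrightarrow> conf_time_inv \<alpha> \<sigma> \<le> conf_time_inv \<alpha> \<tau>"
  using \<alpha> by (auto simp: conf_time_inv_def intro!: powr_mono2)

lemma continuous_on_conf_time: "continuous_on {0..} (conf_time \<alpha>)"
  unfolding conf_time_def[abs_def] using \<alpha> by (intro continuous_intros continuous_on_powr') auto

lemma continuous_on_conf_time_inv: "continuous_on {0..} (conf_time_inv \<alpha>)"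
  unfolding conf_time_inv_def[abs_def] using \<alpha> by (intro continuous_intros continuous_on_powr') auto

lemma continuous_on_compose_conf_time_inv:
  "continuous_on {0..} f \<Longrightarrow> continuous_on {0..} (\<lambda>\<tau>. f (conf_time_inv \<alpha> \<tau>))"
  by (rule continuous_on_compose2[OF _ continuous_on_conf_time_inv]) auto

lemma solves_ode_of_is_solution:
  assumes "is_solution \<alpha> A x"
  shows "solves_ode (\<lambda>\<tau>. blinfun_apply (A (conf_time_inv \<alpha> \<tau>))) (\<lambda>\<tau>. x (conf_time_inv \<alpha> \<tau>))"
  unfolding solves_ode_def
proof (intro conjI allI impI)
  show "continuous_on {0..} (\<lambda>\<tau>. x (conf_time_inv \<alpha> \<tau>))"
    using assms continuous_on_compose_conf_time_inv by (auto simp: is_solution_def)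
next
  fix \<tau> :: real assume "0 < \<tau>"
  define t where "t = conf_time_inv \<alpha> \<tau>"
  have "0 < t" using \<open>0 < \<tau>\<close> \<alpha> by (simp add: t_def conf_time_inv_def)
  have "(\<alpha> * \<tau>) powr (1 / \<alpha> - 1) = t powr (1 - \<alpha>)"
    using \<alpha> by (simp add: t_def conf_time_inv_def powr_powr diff_divide_distrib)
  moreover have "(conf_time_inv \<alpha> has_real_derivative (\<alpha> * \<tau>) powr (1 / \<alpha> - 1)) (at \<tau>)"
    unfolding conf_time_inv_def[abs_def] using \<alpha> \<open>0 < \<tau>\<close>
    by (auto intro!: derivative_eq_intros simp: powr_diff)
  ultimately have 1: "(conf_time_inv \<alpha> has_vector_derivative t powr (1 - \<alpha>)) (at \<tau>)"
    by (simp add: has_real_derivative_iff_has_vector_derivative)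
  have "(x has_vector_derivative (t powr (\<alpha> - 1)) *\<^sub>R A t (x t)) (at t)"
    using assms \<open>0 < t\<close> by (auto simp: is_solution_def has_conf_deriv_def simp flip: conf_quotient_tendsto_iff)
  from vector_diff_chain_at[OF 1 this[unfolded t_def]]
  have "((\<lambda>\<tau>. x (conf_time_inv \<alpha> \<tau>)) has_vector_derivative
      (t powr (1 - \<alpha>) * t powr (\<alpha> - 1)) *\<^sub>R A t (x t)) (at \<tau>)"
    by (simp add: o_def t_def)
  then show "((\<lambda>\<tau>. x (conf_time_inv \<alpha> \<tau>)) has_vector_derivative
      A (conf_time_inv \<alpha> \<tau>) (x (conf_time_inv \<alpha> \<tau>))) (at \<tau>)"
    using \<open>0 < t\<close> by (simp add: t_def flip: powr_add)
qed

lemma is_solution_of_solves_ode: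
  assumes A: "continuous_on {0..} A"
    and y: "solves_ode (\<lambda>\<tau>. blinfun_apply (A (conf_time_inv \<alpha> \<tau>))) y"
  shows "is_solution \<alpha> A (\<lambda>t. y (conf_time \<alpha> t))"
proof -
  define x where "x t = y (conf_time \<alpha> t)" for t
  have cx: "continuous_on {0..} x"
    unfolding x_def using y
    by (intro continuous_on_compose2[OF _ continuous_on_conf_time]) (auto simp: solves_ode_def)
  have pos: "(conf_quotient \<alpha> x t \<longlongrightarrow> A t (x t)) (at 0)" if "0 < t" for t
  proof -
    have "(conf_time \<alpha> has_real_derivative t powr (\<alpha> - 1)) (at t)"
      unfolding conf_time_def[abs_def] using \<alpha> that
      by (auto intro!: derivative_eq_intros simp: powr_diff)
    then have 1: "(conf_time \<alpha> has_vector_derivative t powr (\<alpha> - 1)) (at t)"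
      by (simp add: has_real_derivative_iff_has_vector_derivative)
    have "0 < conf_time \<alpha> t" using \<alpha> that by (simp add: conf_time_def)
    then have "(y has_vector_derivative A t (x t)) (at (conf_time \<alpha> t))"
      using y that unfolding solves_ode_def x_def by fastforce
    from vector_diff_chain_at[OF 1 this] show ?thesis
      unfolding conf_quotient_tendsto_iff[OF that] by (simp add: x_def[abs_def] o_def)
  qed
  have "((\<lambda>s. A s (x s)) \<longlongrightarrow> A 0 (x 0)) (at_right 0)"
  proof (rule tendsto_within_subset)
    have "continuous_on {0..} (\<lambda>s. A s (x s))"
      using A cx by (intro continuous_intros)
    then show "((\<lambda>s. A s (x s)) \<longlongrightarrow> A 0 (x 0)) (at 0 within {0..})"
      by (simp add: continuous_on_def)
  qed auto
  moreover have "\<forall>\<^sub>F s in at_right 0. (conf_quotient \<alpha> x s \<longlongrightarrow> A s (x s)) (at 0)"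
    using eventually_at_right_less[of "0::real"] by (rule eventually_mono) (rule pos)
  ultimately have "has_conf_deriv \<alpha> x (A t (x t)) t" if "0 \<le> t" for t
    using pos[of t] that by (auto simp: has_conf_deriv_def)
  with cx have "is_solution \<alpha> A x" by (simp add: is_solution_def)
  then show ?thesis by (simp only: x_def[abs_def])
qed

lemma evolution_operators_fundamental_solution:
  fixes A :: "real \<Rightarrow> 'z::banach \<Rightarrow>\<^sub>L 'z"
  assumes A: "continuous_on {0..} A"
    and VW: "fundamental_solution (\<lambda>\<tau>. A (conf_time_inv \<alpha> \<tau>)) V W"
  shows "evolution_operators \<alpha> A (\<lambda>t s. V (conf_time \<alpha> t) o\<^sub>L W (conf_time \<alpha> s))"
  unfolding evolution_operators_def
proof (intro conjI allI impI)
  fix x and t s :: real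
  assume x: "is_solution \<alpha> A x" and "0 \<le> t" "0 \<le> s"
  show "x t = (V (conf_time \<alpha> t) o\<^sub>L W (conf_time \<alpha> s)) (x s)"
    using fundamental_solution_apply[OF continuous_on_compose_conf_time_inv[OF A] VW solves_ode_of_is_solution[OF x],
        of "conf_time \<alpha> t" "conf_time \<alpha> s"] \<open>0 \<le> t\<close> \<open>0 \<le> s\<close> by simp
next
  fix t :: real
  show "V (conf_time \<alpha> t) o\<^sub>L W (conf_time \<alpha> t) = id_blinfun"
    using VW by (simp add: fundamental_solution_def)
next
  fix t s r :: real
  have "W (conf_time \<alpha> s) o\<^sub>L V (conf_time \<alpha> s) = id_blinfun"
    using VW by (simp add: fundamental_solution_def)
  then have "W (conf_time \<alpha> s) o\<^sub>L (V (conf_time \<alpha> s) o\<^sub>L X) = X" for X :: "'z \<Rightarrow>\<^sub>L 'z"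
    by (simp flip: blinfun_compose_assoc)
  then show "V (conf_time \<alpha> t) o\<^sub>L W (conf_time \<alpha> s) o\<^sub>L (V (conf_time \<alpha> s) o\<^sub>L W (conf_time \<alpha> r)) =
      V (conf_time \<alpha> t) o\<^sub>L W (conf_time \<alpha> r)"
    by (simp add: blinfun_compose_assoc)
qed

lemma evolution_operators_unique:
  fixes A :: "real \<Rightarrow> 'z::banach \<Rightarrow>\<^sub>L 'z"
  assumes A: "continuous_on {0..} A"
    and VW: "fundamental_solution (\<lambda>\<tau>. A (conf_time_inv \<alpha> \<tau>)) V W"
    and U: "evolution_operators \<alpha> A U" and "0 \<le> t" "0 \<le> s"
  shows "U t s = V (conf_time \<alpha> t) o\<^sub>L W (conf_time \<alpha> s)"
proof (rule blinfun_eqI)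
  fix v
  define y where "y \<tau> = V \<tau> (W (conf_time \<alpha> s) v)" for \<tau>
  have "solves_ode (\<lambda>\<tau>. blinfun_apply (A (conf_time_inv \<alpha> \<tau>))) y"
    unfolding y_def by (rule solves_ode_fundamental_solution_column[OF VW])
  from is_solution_of_solves_ode[OF A this]
  have "y (conf_time \<alpha> t) = U t s (y (conf_time \<alpha> s))"
    using U \<open>0 \<le> t\<close> \<open>0 \<le> s\<close> by (auto simp: evolution_operators_def)
  moreover have "y (conf_time \<alpha> s) = v"
    using VW by (simp add: y_def fundamental_solution_def flip: blinfun_apply_blinfun_compose)
  ultimately show "U t s v = (V (conf_time \<alpha> t) o\<^sub>L W (conf_time \<alpha> s)) v"
    by (simp add: y_def)
qed

lemma exp_dichotomy_of_ml_dichotomy: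
  fixes A :: "real \<Rightarrow> 'z::banach \<Rightarrow>\<^sub>L 'z"
  assumes A: "continuous_on {0..} A"
    and VW: "fundamental_solution (\<lambda>\<tau>. A (conf_time_inv \<alpha> \<tau>)) V W"
    and ml: "ml_dichotomy_with \<alpha> A N1 N2 \<beta>1 \<beta>2 \<epsilon>"
  obtains P where "exp_dichotomy V W P (N1 + N2) (min \<beta>1 \<beta>2) \<epsilon>"
proof -
  have N: "0 < N1" "0 < N2" using ml by (auto simp: ml_dichotomy_with_def)
  obtain U P where U: "evolution_operators \<alpha> A U"
    and *: "\<forall>t\<ge>0. P t o\<^sub>L P t = P t"
      "\<forall>s\<ge>0. \<forall>t\<ge>s. U t s o\<^sub>L P s = P t o\<^sub>L U t s"
      "\<forall>s\<ge>0. \<forall>t\<ge>s. norm (U t s o\<^sub>L P s) \<le> N1 * (mlE \<alpha> \<beta>1 s / mlE \<alpha> \<beta>1 t) * mlE \<alpha> \<epsilon> s"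
      "\<forall>t\<ge>0. \<forall>s\<ge>t. norm (U t s o\<^sub>L (id_blinfun - P s)) \<le> N2 * (mlE \<alpha> \<beta>2 t / mlE \<alpha> \<beta>2 s) * mlE \<alpha> \<epsilon> s"
    using ml unfolding ml_dichotomy_with_def by (elim conjE exE)
  note PP = *(1)[rule_format] and comm = *(2)[rule_format]
    and stable = *(3)[rule_format] and unstable = *(4)[rule_format]
  define h where "h = conf_time_inv \<alpha>"
  have h: "0 \<le> h \<tau>" for \<tau> by (simp add: h_def)
  have ch: "conf_time \<alpha> (h \<tau>) = \<tau>" if "0 \<le> \<tau>" for \<tau> using that by (simp add: h_def)
  have mlE_h: "mlE \<alpha> c (h \<tau>) = exp (c * \<tau>)" if "0 \<le> \<tau>" for c \<tau>
    using that by (simp add: mlE_conf_time ch)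
  have Uh: "U (h \<tau>) (h \<sigma>) = V \<tau> o\<^sub>L W \<sigma>" if "0 \<le> \<tau>" "0 \<le> \<sigma>" for \<tau> \<sigma>
    using evolution_operators_unique[OF A VW U h h, of \<tau> \<sigma>] that by (simp add: ch)
  have WV: "W \<tau> o\<^sub>L (V \<tau> o\<^sub>L X) = X" "V \<tau> o\<^sub>L W \<tau> = id_blinfun"
    if "0 \<le> \<tau>" for \<tau> and X :: "'z \<Rightarrow>\<^sub>L 'z"
    using VW that by (simp_all add: fundamental_solution_def flip: blinfun_compose_assoc)
  have W0: "W 0 = id_blinfun" using VW by (simp add: fundamental_solution_def)
  have Ph: "P (h \<tau>) = V \<tau> o\<^sub>L (P 0 o\<^sub>L W \<tau>)" if "0 \<le> \<tau>" for \<tau>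
  proof -
    have h0: "h 0 = 0" using \<alpha> by (simp add: h_def conf_time_inv_def)
    have "V \<tau> o\<^sub>L P 0 = P (h \<tau>) o\<^sub>L V \<tau>"
      using comm[of 0 "h \<tau>"] Uh[of \<tau> 0] that h by (simp add: h0 W0)
    then have "(V \<tau> o\<^sub>L P 0) o\<^sub>L W \<tau> = (P (h \<tau>) o\<^sub>L V \<tau>) o\<^sub>L W \<tau>" by simp
    then show ?thesis using WV(2)[OF that] by (simp add: blinfun_compose_assoc)
  qed
  have UP: "U (h \<tau>) (h \<sigma>) o\<^sub>L P (h \<sigma>) = V \<tau> o\<^sub>L (P 0 o\<^sub>L W \<sigma>)"
    "U (h \<tau>) (h \<sigma>) o\<^sub>L (id_blinfun - P (h \<sigma>)) = V \<tau> o\<^sub>L ((id_blinfun - P 0) o\<^sub>L W \<sigma>)"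
    if "0 \<le> \<tau>" "0 \<le> \<sigma>" for \<tau> \<sigma>
    using that by (simp_all add: Uh Ph WV(1) blinfun_compose_simps blinfun_compose_assoc)
  have bound: "N * (exp (\<beta> * u) / exp (\<beta> * v)) * exp (\<epsilon> * w) \<le>
      (N1 + N2) * exp (- min \<beta>1 \<beta>2 * (v - u) + \<epsilon> * w)"
    if "0 < N" "N \<le> N1 + N2" "min \<beta>1 \<beta>2 \<le> \<beta>" "u \<le> v" for N \<beta> u v w
  proof -
    have "min \<beta>1 \<beta>2 * (v - u) \<le> \<beta> * (v - u)"
      using that by (intro mult_right_mono) auto
    then have "\<beta> * u - \<beta> * v + \<epsilon> * w \<le> - min \<beta>1 \<beta>2 * (v - u) + \<epsilon> * w"
      unfolding right_diff_distrib mult_minus_left by linarith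
    then have "exp (\<beta> * u - \<beta> * v + \<epsilon> * w) \<le> exp (- min \<beta>1 \<beta>2 * (v - u) + \<epsilon> * w)"
      by (rule iffD2[OF exp_le_cancel_iff])
    then have "N * exp (\<beta> * u - \<beta> * v + \<epsilon> * w) \<le> (N1 + N2) * exp (- min \<beta>1 \<beta>2 * (v - u) + \<epsilon> * w)"
      using that by (intro mult_mono) auto
    then show ?thesis by (simp only: exp_diff exp_add[of "\<beta> * u - \<beta> * v"] mult.assoc)
  qed
  have "exp_dichotomy V W (P 0) (N1 + N2) (min \<beta>1 \<beta>2) \<epsilon>"
    unfolding exp_dichotomy_def
  proof (intro conjI allI impI)
    show "P 0 o\<^sub>L P 0 = P 0" by (simp add: PP)
    show "norm (V \<tau> o\<^sub>L (P 0 o\<^sub>L W \<sigma>)) \<le> (N1 + N2) * exp (- min \<beta>1 \<beta>2 * (\<tau> - \<sigma>) + \<epsilon> * \<sigma>)"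
      if "0 \<le> \<sigma>" "\<sigma> \<le> \<tau>" for \<sigma> \<tau>
    proof -
      have "0 \<le> \<tau>" "h \<sigma> \<le> h \<tau>"
        using that conf_time_inv_mono[OF that] by (auto simp: h_def)
      then have "norm (V \<tau> o\<^sub>L (P 0 o\<^sub>L W \<sigma>)) \<le> N1 * (exp (\<beta>1 * \<sigma>) / exp (\<beta>1 * \<tau>)) * exp (\<epsilon> * \<sigma>)"
        using stable[OF h, of \<sigma> "h \<tau>"] that(1) by (simp only: UP(1) mlE_h)
      also have "\<dots> \<le> (N1 + N2) * exp (- min \<beta>1 \<beta>2 * (\<tau> - \<sigma>) + \<epsilon> * \<sigma>)"
        using N that by (intro bound) auto
      finally show ?thesis .
    qed
    show "norm (V \<tau> o\<^sub>L ((id_blinfun - P 0) o\<^sub>L W \<sigma>)) \<le> (N1 + N2) * exp (- min \<beta>1 \<beta>2 * (\<sigma> - \<tau>) + \<epsilon> * \<sigma>)"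
      if "0 \<le> \<tau>" "\<tau> \<le> \<sigma>" for \<sigma> \<tau>
    proof -
      have "0 \<le> \<sigma>" "h \<tau> \<le> h \<sigma>"
        using that conf_time_inv_mono[OF that] by (auto simp: h_def)
      then have "norm (V \<tau> o\<^sub>L ((id_blinfun - P 0) o\<^sub>L W \<sigma>)) \<le> N2 * (exp (\<beta>2 * \<tau>) / exp (\<beta>2 * \<sigma>)) * exp (\<epsilon> * \<sigma>)"
        using unstable[OF h, of \<tau> "h \<sigma>"] that(1) by (simp only: UP(2) mlE_h)
      also have "\<dots> \<le> (N1 + N2) * exp (- min \<beta>1 \<beta>2 * (\<sigma> - \<tau>) + \<epsilon> * \<sigma>)"
        using N that by (intro bound) auto
      finally show ?thesis .
    qed
  qed
  then show thesis by (rule that)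
qed

lemma admits_ml_dichotomy_of_exp_dichotomy:
  fixes A :: "real \<Rightarrow> 'z::banach \<Rightarrow>\<^sub>L 'z"
  assumes A: "continuous_on {0..} A"
    and VW: "fundamental_solution (\<lambda>\<tau>. A (conf_time_inv \<alpha> \<tau>)) V W"
    and dich: "exp_dichotomy V W P N b \<epsilon>" and "0 < N" "0 < b" "0 \<le> \<epsilon>"
  shows "admits_ml_dichotomy \<alpha> A"
proof -
  let ?g = "conf_time \<alpha>"
  have WV: "W (?g s) o\<^sub>L (V (?g s) o\<^sub>L X) = X" for s and X :: "'z \<Rightarrow>\<^sub>L 'z"
    using VW by (simp add: fundamental_solution_def flip: blinfun_compose_assoc)
  have VW1: "V (?g s) o\<^sub>L W (?g s) = id_blinfun" for s
    using VW by (simp add: fundamental_solution_def)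
  have P: "P o\<^sub>L (P o\<^sub>L X) = P o\<^sub>L X" for X :: "'z \<Rightarrow>\<^sub>L 'z"
    using dich by (simp add: exp_dichotomy_def flip: blinfun_compose_assoc)
  have exp_eq: "exp (- b * (v - u) + \<epsilon> * w) = exp (b * u) / exp (b * v) * exp (\<epsilon> * w)" for u v w
    by (simp add: right_diff_distrib exp_add exp_diff)
  have "ml_dichotomy_with \<alpha> A N N b b \<epsilon>"
    unfolding ml_dichotomy_with_def
  proof (intro conjI exI[of _ "\<lambda>t s. V (?g t) o\<^sub>L W (?g s)"] exI[of _ "\<lambda>t. V (?g t) o\<^sub>L (P o\<^sub>L W (?g t))"] allI impI)
    show "norm (V (?g t) o\<^sub>L W (?g s) o\<^sub>L (V (?g s) o\<^sub>L (P o\<^sub>L W (?g s)))) \<le> N * (mlE \<alpha> b s / mlE \<alpha> b t) * mlE \<alpha> \<epsilon> s"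
      if "0 \<le> s" "s \<le> t" for s t
    proof -
      have "norm (V (?g t) o\<^sub>L (P o\<^sub>L W (?g s))) \<le> N * exp (- b * (?g t - ?g s) + \<epsilon> * ?g s)"
        using dich conf_time_mono[OF that] by (simp add: exp_dichotomy_def)
      then show ?thesis
        unfolding exp_eq by (simp add: WV mlE_conf_time blinfun_compose_assoc)
    qed
    show "norm (V (?g t) o\<^sub>L W (?g s) o\<^sub>L (id_blinfun - (V (?g s) o\<^sub>L (P o\<^sub>L W (?g s))))) \<le>
        N * (mlE \<alpha> b t / mlE \<alpha> b s) * mlE \<alpha> \<epsilon> s" if "0 \<le> t" "t \<le> s" for s t
    proof -
      have "norm (V (?g t) o\<^sub>L ((id_blinfun - P) o\<^sub>L W (?g s))) \<le> N * exp (- b * (?g s - ?g t) + \<epsilon> * ?g s)"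
        using dich conf_time_mono[OF that] by (simp add: exp_dichotomy_def)
      then show ?thesis
        unfolding exp_eq by (simp add: WV mlE_conf_time blinfun_compose_assoc blinfun_compose_simps)
    qed
  qed (use assms evolution_operators_fundamental_solution[OF A VW] in \<open>simp_all add: WV P blinfun_compose_assoc\<close>)
  then show ?thesis unfolding admits_ml_dichotomy_def by blast
qed

end

theorem theorem5p3:
  fixes \<alpha> N1 N2 \<beta>1 \<beta>2 \<epsilon> :: real
    and A :: "real \<Rightarrow> 'z::banach \<Rightarrow>\<^sub>L 'z"
  assumes "0 < \<alpha>" and "\<alpha> \<le> 1"
    and "continuous_on {0..} A"
    and "ml_dichotomy_with \<alpha> A N1 N2 \<beta>1 \<beta>2 \<epsilon>"
    and "\<epsilon> < min \<beta>1 \<beta>2"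
  shows "\<exists>\<delta>0>0. \<forall>\<delta><\<delta>0. \<delta> * (N1 / \<beta>1 + N2 / \<beta>2) < 1 \<longrightarrow>
           (\<forall>B :: real \<Rightarrow> 'z \<Rightarrow>\<^sub>L 'z.
              continuous_on {0..} B \<and> bounded (B ` {0..}) \<and>
              (\<forall>t\<ge>0. norm (B t) \<le> \<delta> / mlE \<alpha> (2 * \<epsilon>) t) \<longrightarrow>
              admits_ml_dichotomy \<alpha> (\<lambda>t. A t + B t))"
proof -
  define N where "N = N1 + N2"
  define b where "b = min \<beta>1 \<beta>2"
  have N: "0 < N" and \<epsilon>: "0 \<le> \<epsilon>" "\<epsilon> < b"
    using assms(4,5) by (auto simp: ml_dichotomy_with_def N_def b_def)
  note conf_time_inv = continuous_on_compose_conf_time_inv[OF assms(1)]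
  obtain V W where VW: "fundamental_solution (\<lambda>\<tau>. A (conf_time_inv \<alpha> \<tau>)) V W"
    using fundamental_solution_exists[OF conf_time_inv[OF assms(3)]] .
  obtain P where P: "exp_dichotomy V W P N b \<epsilon>"
    using exp_dichotomy_of_ml_dichotomy[OF assms(1,3) VW assms(4)] unfolding N_def b_def .
  define \<delta>0 where "\<delta>0 = (b - \<epsilon>) / (8 * N * (1 + N))"
  have "admits_ml_dichotomy \<alpha> (\<lambda>t. A t + B t)"
    if "\<delta> < \<delta>0" and B: "continuous_on {0..} B" "\<And>t. 0 \<le> t \<Longrightarrow> norm (B t) \<le> \<delta> / mlE \<alpha> (2 * \<epsilon>) t"
    for \<delta> and B :: "real \<Rightarrow> 'z \<Rightarrow>\<^sub>L 'z"
  proof -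
    have "0 \<le> \<delta>"
      using order_trans[OF norm_ge_zero B(2)[of 0]] by (simp add: mlE_def)
    have "\<delta> * (8 * N * (1 + N)) \<le> b - \<epsilon>"
      using \<open>\<delta> < \<delta>0\<close> N by (simp add: \<delta>0_def pos_less_divide_eq)
    moreover have "\<delta> * (8 * N * (1 + N)) = 8 * \<delta> * N + 8 * \<delta> * N\<^sup>2"
      by (simp add: algebra_simps power2_eq_square)
    moreover have "0 \<le> 8 * \<delta> * N" "0 \<le> 8 * \<delta> * N\<^sup>2"
      using \<open>0 \<le> \<delta>\<close> N by auto
    ultimately have small: "8 * \<delta> * N \<le> b - \<epsilon>" "8 * \<delta> * N\<^sup>2 \<le> b"
      using \<epsilon> by linarith+
    have AB: "continuous_on {0..} (\<lambda>t. A t + B t)"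
      using assms(3) B(1) by (rule continuous_on_add)
    obtain V' W' where fund': "fundamental_solution (\<lambda>\<tau>. A (conf_time_inv \<alpha> \<tau>) + B (conf_time_inv \<alpha> \<tau>)) V' W'"
      using fundamental_solution_exists[OF conf_time_inv[OF AB]] .
    interpret perturbed_dichotomy "\<lambda>\<tau>. A (conf_time_inv \<alpha> \<tau>)" "\<lambda>\<tau>. B (conf_time_inv \<alpha> \<tau>)" V W V' W' P N b \<epsilon> \<delta>
    proof
      show "norm (B (conf_time_inv \<alpha> \<tau>)) \<le> \<delta> * exp (- 2 * \<epsilon> * \<tau>)" if "0 \<le> \<tau>" for \<tau>
        using B(2)[OF conf_time_inv_nonneg[OF assms(1)], of \<tau>]
        by (simp add: mlE_conf_time conf_time_inverse(2)[OF assms(1) that] exp_minus divide_inverse)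
    qed (use conf_time_inv assms(3) B(1) VW fund' P N \<epsilon> \<open>0 \<le> \<delta>\<close> small in auto)
    obtain P' where P': "exp_dichotomy V' W' P' (4 * N\<^sup>2) b' (2 * \<epsilon>)"
      using dichotomy' .
    then show ?thesis
      using N b'(3) \<epsilon>(1) by (intro admits_ml_dichotomy_of_exp_dichotomy[OF assms(1) AB fund' P']) auto
  qed
  moreover have "0 < \<delta>0"
    using N \<epsilon> by (simp add: \<delta>0_def)
  ultimately show ?thesis by blast
qed

end
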